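(* Let $p$ be an odd prime and let $G$ be a finite power-closed $p$-group. Then $G$ is a $J$-group and $\mathcal{B}(\gamma_d(G))\subseteq\mathcal{W}(G)$, where $d$ is the largest integer with $\exp(\gamma_d(G))=\exp(G)$.
   Context: A section of a group is a quotient of a subgroup. A $p$-group $G$ is power-closed if in every section of $G$ and for every $m\ge 1$, products of $p^m$-th powers are $p^m$-th powers. A group $G$ is a $J$-group if there exist an element $k\in G$ and a function $f\colon G\to G$ with $f(xk)=xf(x)$ for all $x\in G$. An element $k\in G$ of finite order $n=|k|$ is a witness for $G$ if $\prod_{i=1}^{n} xk^{n-i}=1$ for all $x\in G$, where the product is taken in order of increasing $i$ from left to right, i.e. it equals $xk^{n-1}xk^{n-2}\cdots xk^2\,xk\,x$. $\mathcal{W}(G)$ denotes the set of all witnesses for $G$. The exponent is $\exp(G)=\mathrm{lcm}\{|g| : g\in G\}$, and $\mathcal{B}(G)=\{x\in G : |x|=\exp(G)\}$ (for a subgroup $H$, $\mathcal{B}(H)$ is defined with respect to $\exp(H)$). The lower central series is $\gamma_1(G)=G$, $\gamma_{i+1}(G)=[\gamma_i(G),G]$. If $G$ is trivial, so that no largest $d$ exists, $d$ is taken to be $1$. *)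

theory Defs
  imports "HOL-Algebra.Algebra"
begin

definition finite_p_group :: "nat \<Rightarrow> ('a, 'b) monoid_scheme \<Rightarrow> bool" where
  "finite_p_group p G \<longleftrightarrow> group G \<and> finite (carrier G) \<and> (\<exists>n. order G = p ^ n)"

(* The quotients G\<lparr>carrier := H\<rparr> Mod N below are the sections of G.  Closure under
   binary products is the same as closure under arbitrary finite products. *)
definition power_closed :: "nat \<Rightarrow> ('a, 'b) monoid_scheme \<Rightarrow> bool" where
  "power_closed p G \<longleftrightarrow>
    (\<forall>H N. subgroup H G \<longrightarrow> N \<lhd> G\<lparr>carrier := H\<rparr> \<longrightarrow>
      (let S = G\<lparr>carrier := H\<rparr> Mod N in
        \<forall>m\<ge>1. \<forall>x\<in>carrier S. \<forall>y\<in>carrier S. \<exists>z\<in>carrier S.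
          (x [^]\<^bsub>S\<^esub> (p ^ m :: nat)) \<otimes>\<^bsub>S\<^esub> (y [^]\<^bsub>S\<^esub> (p ^ m :: nat)) = z [^]\<^bsub>S\<^esub> (p ^ m :: nat)))"

definition J_group :: "('a, 'b) monoid_scheme \<Rightarrow> bool" where
  "J_group G \<longleftrightarrow> group G \<and>
    (\<exists>k\<in>carrier G. \<exists>f\<in>carrier G \<rightarrow> carrier G.
      \<forall>x\<in>carrier G. f (x \<otimes>\<^bsub>G\<^esub> k) = x \<otimes>\<^bsub>G\<^esub> f x)"

(* group.ord G k is 0 exactly when k has infinite order, so positivity says that |k| is finite.
   With n = |k|, the list [1..<Suc n] is 1, ..., n, and the ordered product is
   x k^(n-1) x k^(n-2) ... x k^2 x k x. *)
definition witnesses :: "('a, 'b) monoid_scheme \<Rightarrow> 'a set" where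
  "witnesses G = {k \<in> carrier G. group.ord G k > 0 \<and>
    (\<forall>x\<in>carrier G.
      foldr (\<otimes>\<^bsub>G\<^esub>)
        (map (\<lambda>i. x \<otimes>\<^bsub>G\<^esub> (k [^]\<^bsub>G\<^esub> (group.ord G k - i))) [1..<Suc (group.ord G k)])
        \<one>\<^bsub>G\<^esub> = \<one>\<^bsub>G\<^esub>)}"

definition group_exp :: "('a, 'b) monoid_scheme \<Rightarrow> nat" where
  "group_exp G = Lcm (group.ord G ` carrier G)"

definition max_order_elements :: "('a, 'b) monoid_scheme \<Rightarrow> 'a set" where
  "max_order_elements G = {x \<in> carrier G. group.ord G x = group_exp G}"

definition commutator_subgroup :: "('a, 'b) monoid_scheme \<Rightarrow> 'a set \<Rightarrow> 'a set \<Rightarrow> 'a set" where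
  "commutator_subgroup G H K =
    generate G (\<Union>h\<in>H. \<Union>k\<in>K. {h \<otimes>\<^bsub>G\<^esub> k \<otimes>\<^bsub>G\<^esub> inv\<^bsub>G\<^esub> h \<otimes>\<^bsub>G\<^esub> inv\<^bsub>G\<^esub> k})"

(* The series is indexed from 1; the value at 0 is a dummy. *)
fun lower_central :: "('a, 'b) monoid_scheme \<Rightarrow> nat \<Rightarrow> 'a set" where
  "lower_central G 0 = carrier G"
| "lower_central G (Suc 0) = carrier G"
| "lower_central G (Suc (Suc i)) = commutator_subgroup G (lower_central G (Suc i)) (carrier G)"

abbreviation lower_central_group ::
    "('a, 'b) monoid_scheme \<Rightarrow> nat \<Rightarrow> ('a, 'b) monoid_scheme" where
  "lower_central_group G i \<equiv> G\<lparr>carrier := lower_central G i\<rparr>"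

(* For a nontrivial nilpotent G only finitely many d qualify, and d = 1 does, so the maximum
   exists; for the trivial group every d qualifies. *)
definition exp_depth :: "('a, 'b) monoid_scheme \<Rightarrow> nat" where
  "exp_depth G =
    (if trivial_group G then 1
     else (GREATEST d. d \<ge> 1 \<and> group_exp (lower_central_group G d) = group_exp G))"

end

theory Submission
  imports Defs
begin

text \<open>
  Put \<open>W\<^sub>n(x) = x k ^ (n - 1) x k ^ (n - 2) \<dots> x k x\<close>. An element \<open>k\<close> of order \<open>n\<close> is a witness iff
  \<open>W\<^sub>n\<close> is identically \<open>\<one>\<close>, and then setting \<open>f (r k ^ i) = W\<^sub>i(r)\<close> for representatives \<open>r\<close> of the cosets of
  the subgroup generated by \<open>k\<close> makes \<open>G\<close> a J-group (\<open>witness_imp_J_group\<close>).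

  Let \<open>G\<close> have exponent \<open>p ^ (e + 1)\<close>, let \<open>k\<close> be an element of this order in \<open>\<gamma>\<^sub>d(G)\<close>, and
  \<open>M = \<gamma>\<^sub>d\<^sub>+\<^sub>1(G)\<close>. By the choice of \<open>d\<close> the exponent of \<open>M\<close> divides \<open>p ^ e\<close>, and all commutators with \<open>k\<close> lie in
  \<open>M\<close>. From this \<open>W\<close> vanishes at length \<open>p ^ (e + 1)\<close> by induction on \<open>e\<close> (\<open>witness_prod_eq_one\<close>). With
  \<open>n = p ^ e\<close> and \<open>e > 0\<close>, induction in the quotient of \<open>G\<close> by the \<open>n\<close>-th powers and by the
  \<open>n / p\<close>-th powers of elements of \<open>M\<close> shows \<open>W\<^sub>n(x) = a ^ n c ^ (n / p)\<close> with \<open>c\<close> in \<open>M\<close>. If \<open>n\<close>-th powers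
  commute with \<open>M\<close>, then \<open>W\<^sub>n(x)\<close> has order dividing \<open>p\<close>; if moreover \<open>k ^ n\<close> is central, then the
  product of length \<open>p n\<close> is just \<open>W\<^sub>n(x) ^ p = \<one>\<close>.

  Both commutation properties are instances of the key fact \<open>pow_central_of_commutators_bounded\<close>: if \<open>G\<close> has exponent
  dividing \<open>p ^ (m + 1)\<close>, the normal subgroup \<open>M\<close> has exponent dividing \<open>p ^ m\<close>, and all commutators with \<open>u\<close> lie
  in \<open>M\<close>, then \<open>u ^ (p ^ m)\<close> is central. The group \<open>K\<close> generated by \<open>u\<close> and \<open>M\<close> is normal, and since \<open>G\<close> is power-closed
  its \<open>p ^ m\<close>-th powers form a normal subgroup of \<open>G\<close>. It suffices to see that the latter has at most
  \<open>p\<close> elements, because normal subgroups of order \<open>p\<close> are central. Two facts give the bound.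

  First, if \<open>p ^ m\<close>-th powers are trivial on a normal subgroup of index \<open>p\<close>, then the group has at most
  \<open>p\<close> of them (\<open>card_power_image_le\<close>). This is a count: the group is covered by that subgroup and \<open>p\<close> proper subgroups
  to which induction applies, so it has at most \<open>1 + p (p - 1)\<close> of these powers, and their number is a power of \<open>p\<close>.

  Second, \<open>p ^ m\<close>-th powers are trivial on the subgroup of \<open>K\<close> generated by \<open>u ^ p\<close> and \<open>M\<close>
  (\<open>cyc_ext_pow_exponent\<close>). Here the oddness of \<open>p\<close> is used: by the first fact and induction the elements in question are
  \<open>p\<close>-th powers of products of two elements of order dividing \<open>p\<close> whose commutator is central of order dividing \<open>p\<close>.
\<close>

section \<open>Power-closed groups, subgroups and quotients\<close>

lemma nat_pow_subgroup [simp]: "x [^]\<^bsub>G\<lparr>carrier := H\<rparr>\<^esub> (n::nat) = x [^]\<^bsub>G\<^esub> n"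
  by (simp add: nat_pow_def)

lemma (in subgroup) subgroup_nat_pow_closed: "x \<in> H \<Longrightarrow> x [^] (n::nat) \<in> H"
  by (induction n) (simp_all add: one_closed)

text \<open>Being power-closed, written with representatives: the \<open>p ^ m\<close>-th powers in the section
  \<open>H / N\<close> are the cosets of \<open>p ^ m\<close>-th powers in \<open>H\<close>. In this form the property passes easily
  through homomorphisms.\<close>

lemma power_closed_iff_cosets:
  assumes "group G"
  shows "power_closed p G \<longleftrightarrow>
    (\<forall>H N. subgroup H G \<longrightarrow> N \<lhd> G\<lparr>carrier := H\<rparr> \<longrightarrow>
      (\<forall>m\<ge>1. \<forall>x\<in>H. \<forall>y\<in>H. \<exists>z\<in>H.
        N #>\<^bsub>G\<^esub> (x [^]\<^bsub>G\<^esub> (p ^ m :: nat) \<otimes>\<^bsub>G\<^esub> y [^]\<^bsub>G\<^esub> (p ^ m :: nat))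
          = N #>\<^bsub>G\<^esub> z [^]\<^bsub>G\<^esub> (p ^ m :: nat)))"
proof -
  have section_eq: "(let S = G\<lparr>carrier := H\<rparr> Mod N in
        \<forall>m\<ge>1. \<forall>x\<in>carrier S. \<forall>y\<in>carrier S. \<exists>z\<in>carrier S.
          (x [^]\<^bsub>S\<^esub> (p ^ m :: nat)) \<otimes>\<^bsub>S\<^esub> (y [^]\<^bsub>S\<^esub> (p ^ m :: nat)) = z [^]\<^bsub>S\<^esub> (p ^ m :: nat))
     \<longleftrightarrow> (\<forall>m\<ge>1. \<forall>x\<in>H. \<forall>y\<in>H. \<exists>z\<in>H.
        N #>\<^bsub>G\<^esub> (x [^]\<^bsub>G\<^esub> (p ^ m :: nat) \<otimes>\<^bsub>G\<^esub> y [^]\<^bsub>G\<^esub> (p ^ m :: nat))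
          = N #>\<^bsub>G\<^esub> z [^]\<^bsub>G\<^esub> (p ^ m :: nat))"
    if H: "subgroup H G" and N: "N \<lhd> G\<lparr>carrier := H\<rparr>" for H N
  proof -
    interpret group G by fact
    interpret H: group "G\<lparr>carrier := H\<rparr>" using H by (rule subgroup_imp_group)
    interpret N: normal N "G\<lparr>carrier := H\<rparr>" by fact
    have pow: "(N #>\<^bsub>G\<^esub> x) [^]\<^bsub>G\<lparr>carrier := H\<rparr> Mod N\<^esub> (n::nat) = N #>\<^bsub>G\<^esub> x [^]\<^bsub>G\<^esub> n" if "x \<in> H" for x n
      using N.FactGroup_pow[of x n] that by simp
    have mult: "(N #>\<^bsub>G\<^esub> x) \<otimes>\<^bsub>G\<lparr>carrier := H\<rparr> Mod N\<^esub> (N #>\<^bsub>G\<^esub> y) = N #>\<^bsub>G\<^esub> (x \<otimes>\<^bsub>G\<^esub> y)"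
      if "x \<in> H" "y \<in> H" for x y
      using N.rcos_sum[of x y] that by simp
    have cl: "x [^]\<^bsub>G\<^esub> (n::nat) \<in> H" if "x \<in> H" for x n
      using H.nat_pow_closed[of x n] that by simp
    have car: "carrier (G\<lparr>carrier := H\<rparr> Mod N) = (\<lambda>x. N #>\<^bsub>G\<^esub> x) ` H"
      by (simp add: carrier_FactGroup)
    show ?thesis
      unfolding Let_def car ball_simps bex_simps
      by (simp add: pow mult cl del: mult_FactGroup cong: ball_cong bex_cong)
  qed
  show ?thesis
    unfolding power_closed_def by (simp only: section_eq cong: imp_cong)
qed

text \<open>The section \<open>G / {\<one>}\<close>; the case \<open>m = 0\<close>, which the definition leaves out, is trivial.\<close>

lemma power_closed_product_of_powers:
  fixes G (structure)
  assumes G: "group G" "power_closed p G" and x: "x \<in> carrier G" and y: "y \<in> carrier G"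
  shows "\<exists>z\<in>carrier G. x [^]\<^bsub>G\<^esub> (p ^ m :: nat) \<otimes>\<^bsub>G\<^esub> y [^]\<^bsub>G\<^esub> (p ^ m :: nat) = z [^]\<^bsub>G\<^esub> (p ^ m :: nat)"
proof (cases "m = 0")
  case True
  interpret group G by fact
  show ?thesis using x y True by (intro bexI[of _ "x \<otimes>\<^bsub>G\<^esub> y"]) auto
next
  case False
  interpret group G by fact
  have "{\<one>} \<lhd> G\<lparr>carrier := carrier G\<rparr>" using one_is_normal by simp
  then obtain z where "z \<in> carrier G"
    "{\<one>} #> (x [^] (p ^ m :: nat) \<otimes> y [^] (p ^ m :: nat)) = {\<one>} #> z [^] (p ^ m :: nat)"
    using G(2)[unfolded power_closed_iff_cosets[OF G(1)]] subgroup_self x y False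
    by (metis One_nat_def Suc_leI neq0_conv)
  then show ?thesis using x y by (auto simp: r_coset_def intro!: bexI[of _ z])
qed

lemma power_closed_subgroup:
  assumes "group G" "power_closed p G" "subgroup H G"
  shows "power_closed p (G\<lparr>carrier := H\<rparr>)"
proof -
  interpret group G by fact
  have "subgroup K G" if "subgroup K (G\<lparr>carrier := H\<rparr>)" for K
    using incl_subgroup assms(3) that by blast
  then show ?thesis
    using assms(2) unfolding power_closed_def by (auto simp: Let_def)
qed

text \<open>A surjective homomorphism with kernel \<open>N\<close> presents \<open>Q\<close> as \<open>G / N\<close> without committing to a
  construction of the quotient.\<close>

locale quotient_hom = group_hom G Q h for G (structure) and Q (structure) and h +
  fixes N
  assumes surj: "h ` carrier G = carrier Q"
    and kernel_eq: "kernel G Q h = N"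
begin

lemma ker: "x \<in> carrier G \<Longrightarrow> h x = \<one>\<^bsub>Q\<^esub> \<longleftrightarrow> x \<in> N"
  unfolding kernel_eq[symmetric] kernel_def by simp

lemma normal_N: "N \<lhd> G"
  using normal_kernel unfolding kernel_eq .

lemma order_eq: "order G = order Q * card N"
proof -
  interpret N: normal N G by (rule normal_N)
  have "(\<lambda>A. the_elem (h ` A)) \<in> iso (G Mod N) Q"
    using FactGroup_iso_set surj unfolding kernel_eq by simp
  then have "order (G Mod N) = order Q"
    unfolding iso_def order_def using bij_betw_same_card by auto
  then show ?thesis
    using G.lagrange[OF N.subgroup_axioms] by (simp add: order_def FactGroup_def)
qed

lemma lift: 
  assumes "y \<in> carrier Q" obtains x where "x \<in> carrier G" "h x = y"
  using assms surj by (metis imageE)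

lemma subgroup_vimage:
  assumes "subgroup K Q" shows "subgroup {x \<in> carrier G. h x \<in> K} G"
proof -
  interpret K: subgroup K Q by fact
  show ?thesis by (unfold_locales) auto
qed

lemma normal_vimage:
  assumes "K \<lhd> Q" shows "{x \<in> carrier G. h x \<in> K} \<lhd> G"
proof (rule G.normal_invI)
  interpret K: normal K Q by fact
  show "subgroup {x \<in> carrier G. h x \<in> K} G" using subgroup_vimage K.subgroup_axioms by blast
  show "x \<otimes> y \<otimes> inv x \<in> {x \<in> carrier G. h x \<in> K}" if "x \<in> carrier G" "y \<in> {x \<in> carrier G. h x \<in> K}" for x y
    using that K.inv_op_closed2[of "h x" "h y"] by auto
qed

lemma normal_image:
  assumes "K \<lhd> G" shows "h ` K \<lhd> Q"
proof (rule H.normal_invI)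
  interpret K: normal K G by fact
  show "subgroup (h ` K) Q" using subgroup_img_is_subgroup K.subgroup_axioms by blast
  show "x \<otimes>\<^bsub>Q\<^esub> y \<otimes>\<^bsub>Q\<^esub> inv\<^bsub>Q\<^esub> x \<in> h ` K" if xy: "x \<in> carrier Q" "y \<in> h ` K" for x y
  proof -
    obtain a b where "a \<in> carrier G" "h a = x" "b \<in> K" "h b = y" using xy lift[of x] by blast
    then show ?thesis
      by (intro image_eqI[of _ _ "a \<otimes> b \<otimes> inv a"]) (auto simp: K.inv_op_closed2)
  qed
qed

text \<open>The section \<open>K / L\<close> of the image is isomorphic to the section \<open>h\<inverse>(K) / h\<inverse>(L)\<close> of \<open>G\<close>.\<close>

lemma power_closed_image:
  assumes "power_closed p G" shows "power_closed p Q"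
  unfolding power_closed_iff_cosets[OF H.group_axioms]
proof (intro allI impI ballI)
  fix K L and m :: nat and x y
  assume K: "subgroup K Q" and L: "L \<lhd> Q\<lparr>carrier := K\<rparr>" and m: "1 \<le> m" and xy: "x \<in> K" "y \<in> K"
  let ?K = "{x \<in> carrier G. h x \<in> K}" let ?L = "{x \<in> carrier G. h x \<in> L}"
  interpret K: subgroup K Q by fact
  interpret K: group "Q\<lparr>carrier := K\<rparr>" using K by (rule H.subgroup_imp_group)
  interpret L: normal L "Q\<lparr>carrier := K\<rparr>" by fact
  have LK: "L \<subseteq> K" using L.subset by simp
  have K': "subgroup ?K G" using K by (rule subgroup_vimage)
  interpret K': group "G\<lparr>carrier := ?K\<rparr>" using K' by (rule G.subgroup_imp_group)
  have LQ: "subgroup L Q" using H.incl_subgroup[OF K] L.subgroup_axioms by blast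
  have L': "subgroup ?L G" using LQ by (rule subgroup_vimage)
  have "?L \<lhd> G\<lparr>carrier := ?K\<rparr>"
  proof (rule K'.normal_invI)
    show "subgroup ?L (G\<lparr>carrier := ?K\<rparr>)"
      using L' K' LK by (intro G.subgroup_incl) auto
    fix x y assume x: "x \<in> carrier (G\<lparr>carrier := ?K\<rparr>)" and y: "y \<in> ?L"
    have "inv\<^bsub>G\<lparr>carrier := ?K\<rparr>\<^esub> x = inv x" using K' x by (intro G.m_inv_consistent) auto
    moreover have "inv\<^bsub>Q\<lparr>carrier := K\<rparr>\<^esub> (h x) = inv\<^bsub>Q\<^esub> (h x)" using K x by (intro H.m_inv_consistent) auto
    ultimately show "x \<otimes>\<^bsub>G\<lparr>carrier := ?K\<rparr>\<^esub> y \<otimes>\<^bsub>G\<lparr>carrier := ?K\<rparr>\<^esub> inv\<^bsub>G\<lparr>carrier := ?K\<rparr>\<^esub> x \<in> ?L"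
      using L.inv_op_closed2[of "h x" "h y"] x y by auto
  qed
  moreover obtain a b where ab: "a \<in> ?K" "b \<in> ?K" "h a = x" "h b = y"
    using xy lift by (metis (mono_tags, lifting) K.mem_carrier mem_Collect_eq)
  ultimately obtain c where c: "c \<in> ?K"
    "?L #> (a [^] (p ^ m :: nat) \<otimes> b [^] (p ^ m :: nat)) = ?L #> c [^] (p ^ m :: nat)"
    using assms[unfolded power_closed_iff_cosets[OF G.group_axioms], rule_format, OF K' _ m] by blast
  have "a [^] (p ^ m :: nat) \<otimes> b [^] (p ^ m :: nat) \<in> ?L #> c [^] (p ^ m :: nat)"
    unfolding c(2)[symmetric] using ab L' by (intro G.rcos_self) auto
  then obtain l where l: "l \<in> ?L" "a [^] (p ^ m :: nat) \<otimes> b [^] (p ^ m :: nat) = l \<otimes> c [^] (p ^ m :: nat)"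
    by (auto simp: r_coset_def)
  have "x [^]\<^bsub>Q\<^esub> (p ^ m :: nat) \<otimes>\<^bsub>Q\<^esub> y [^]\<^bsub>Q\<^esub> (p ^ m :: nat) = h l \<otimes>\<^bsub>Q\<^esub> (h c) [^]\<^bsub>Q\<^esub> (p ^ m :: nat)"
    using arg_cong[OF l(2), of h] l(1) ab c(1) by (simp add: hom_nat_pow)
  then have "x [^]\<^bsub>Q\<^esub> (p ^ m :: nat) \<otimes>\<^bsub>Q\<^esub> y [^]\<^bsub>Q\<^esub> (p ^ m :: nat) \<in> L #>\<^bsub>Q\<^esub> (h c) [^]\<^bsub>Q\<^esub> (p ^ m :: nat)"
    using l(1) by (auto simp: r_coset_def)
  then have "L #>\<^bsub>Q\<^esub> (x [^]\<^bsub>Q\<^esub> (p ^ m :: nat) \<otimes>\<^bsub>Q\<^esub> y [^]\<^bsub>Q\<^esub> (p ^ m :: nat)) = L #>\<^bsub>Q\<^esub> (h c) [^]\<^bsub>Q\<^esub> (p ^ m :: nat)"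
    using H.repr_independence[OF _ _ LQ] c(1) by (metis (mono_tags, lifting) H.nat_pow_closed K.mem_carrier mem_Collect_eq)
  then show "\<exists>z\<in>K. L #>\<^bsub>Q\<^esub> (x [^]\<^bsub>Q\<^esub> (p ^ m :: nat) \<otimes>\<^bsub>Q\<^esub> y [^]\<^bsub>Q\<^esub> (p ^ m :: nat)) = L #>\<^bsub>Q\<^esub> z [^]\<^bsub>Q\<^esub> (p ^ m :: nat)"
    using c(1) by blast
qed

end

section \<open>Quotients in the type of the group, and cyclic extensions\<close>

text \<open>The quotient by \<open>H\<close> lives on a transversal of the cosets, so it has the type of \<open>G\<close> itself.
  Every induction below replaces a group by subgroups and quotients of it; the induction hypothesis
  ranges over one type, which the quotient groups of cosets would leave.\<close>

lemma (in normal) exists_quotient_hom: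
  obtains Q :: "('a, 'b) monoid_scheme" and h where "quotient_hom G Q h H"
proof -
  define rep where "rep x = (SOME y. y \<in> H #> x)" for x
  define Q where "Q = G\<lparr>carrier := rep ` carrier G, mult := \<lambda>x y. rep (x \<otimes> y), one := rep \<one>\<rparr>"
  have rep_in: "rep x \<in> H #> x" if "x \<in> carrier G" for x
    unfolding rep_def using rcos_self[OF that subgroup_axioms] by (rule someI)
  have rep_closed [simp]: "rep x \<in> carrier G" if "x \<in> carrier G" for x
    using rep_in[OF that] that r_coset_subset_G subset by blast
  have coset_rep: "H #> rep x = H #> x" if "x \<in> carrier G" for x
    using repr_independence[OF rep_in[OF that] that subgroup_axioms] by simp
  have rep_cong: "rep x = rep y" if "H #> x = H #> y" for x y
    unfolding rep_def that ..
  have rep_iff: "rep x = rep y \<longleftrightarrow> H #> x = H #> y" if "x \<in> carrier G" "y \<in> carrier G" for x y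
    using that coset_rep rep_cong by metis
  have rep_mult: "rep (rep x \<otimes> rep y) = rep (x \<otimes> y)" if "x \<in> carrier G" "y \<in> carrier G" for x y
    using that by (intro rep_cong) (simp add: rcos_sum[symmetric] coset_rep)
  have rep_mult_left: "rep (rep x \<otimes> y) = rep (x \<otimes> y)" if "x \<in> carrier G" "y \<in> carrier G" for x y
    using that by (intro rep_cong) (simp add: rcos_sum[symmetric] coset_rep)
  have rep_mult_right: "rep (x \<otimes> rep y) = rep (x \<otimes> y)" if "x \<in> carrier G" "y \<in> carrier G" for x y
    using that by (intro rep_cong) (simp add: rcos_sum[symmetric] coset_rep)
  have "group Q"
  proof (rule groupI)
    show "\<exists>y\<in>carrier Q. y \<otimes>\<^bsub>Q\<^esub> x = \<one>\<^bsub>Q\<^esub>" if x: "x \<in> carrier Q" for x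
    proof -
      obtain a where "a \<in> carrier G" "x = rep a" using x by (auto simp: Q_def)
      then show ?thesis by (intro bexI[of _ "rep (inv a)"]) (auto simp: Q_def rep_mult)
    qed
  qed (auto simp: Q_def rep_mult_left rep_mult_right m_assoc)
  moreover have "rep \<in> hom G Q" by (auto simp: hom_def Q_def rep_mult)
  moreover have "rep x = \<one>\<^bsub>Q\<^esub> \<longleftrightarrow> x \<in> H" if "x \<in> carrier G" for x
  proof -
    have "rep x = \<one>\<^bsub>Q\<^esub> \<longleftrightarrow> H #> x = H #> \<one>" using rep_iff[OF that] by (simp add: Q_def)
    also have "\<dots> \<longleftrightarrow> x \<in> H"
      using coset_join1[OF _ that subgroup_axioms] coset_join2[OF that subgroup_axioms] subset by auto
    finally show ?thesis .
  qed
  moreover have "rep ` carrier G = carrier Q" by (simp add: Q_def)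
  ultimately have "quotient_hom G Q rep H"
    using subset
    by (auto simp: kernel_def quotient_hom_def quotient_hom_axioms_def group_hom_def group_hom_axioms_def)
  then show thesis by (rule that)
qed


text \<open>For \<open>N\<close> normal and \<open>w\<close> of finite order this is the subgroup generated by \<open>N\<close> and \<open>w\<close>: the preimage
  of the cyclic subgroup generated by the image of \<open>w\<close> in \<open>G / N\<close>. In a finite group, exponents in \<open>nat\<close> also
  give the inverses.\<close>

definition cyc_ext :: "('a, 'b) monoid_scheme \<Rightarrow> 'a set \<Rightarrow> 'a \<Rightarrow> 'a set" where
  "cyc_ext G N w = {w [^]\<^bsub>G\<^esub> (i::nat) \<otimes>\<^bsub>G\<^esub> c | i c. c \<in> N}"

lemma cyc_extI: "c \<in> N \<Longrightarrow> w [^]\<^bsub>G\<^esub> (i::nat) \<otimes>\<^bsub>G\<^esub> c \<in> cyc_ext G N w"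
  unfolding cyc_ext_def by blast

lemma cyc_extE:
  assumes "g \<in> cyc_ext G N w"
  obtains i :: nat and c where "c \<in> N" "g = w [^]\<^bsub>G\<^esub> i \<otimes>\<^bsub>G\<^esub> c"
  using assms unfolding cyc_ext_def by blast

lemma cyc_ext_subgroup_carrier [simp]: "cyc_ext (G\<lparr>carrier := H\<rparr>) N w = cyc_ext G N w"
  by (simp add: cyc_ext_def)

context quotient_hom
begin

lemma cyc_ext_eq:
  assumes "w \<in> carrier G"
  shows "cyc_ext G N w = {g \<in> carrier G. \<exists>i::nat. h g = h w [^]\<^bsub>Q\<^esub> i}"
proof (intro equalityI subsetI)
  interpret N: normal N G by (rule normal_N)
  fix g assume "g \<in> cyc_ext G N w"
  then obtain i :: nat and c where c: "c \<in> N" and g: "g = w [^] i \<otimes> c" by (rule cyc_extE)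
  have "h c = \<one>\<^bsub>Q\<^esub>" using ker[of c] c by simp
  then have "h g = h w [^]\<^bsub>Q\<^esub> i" using assms c g by (simp add: hom_nat_pow)
  moreover have "g \<in> carrier G" using assms c g by simp
  ultimately show "g \<in> {g \<in> carrier G. \<exists>i::nat. h g = h w [^]\<^bsub>Q\<^esub> i}" by blast
next
  fix g assume "g \<in> {g \<in> carrier G. \<exists>i::nat. h g = h w [^]\<^bsub>Q\<^esub> i}"
  then obtain i :: nat where g: "g \<in> carrier G" "h g = h w [^]\<^bsub>Q\<^esub> i" by auto
  then have "h (inv (w [^] i) \<otimes> g) = \<one>\<^bsub>Q\<^esub>" using assms by (simp add: hom_nat_pow)
  then have "inv (w [^] i) \<otimes> g \<in> N" using assms g(1) ker[of "inv (w [^] i) \<otimes> g"] by simp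
  moreover have "g = w [^] i \<otimes> (inv (w [^] i) \<otimes> g)" using assms g by (simp add: G.m_assoc[symmetric])
  ultimately show "g \<in> cyc_ext G N w" by (auto simp: cyc_ext_def)
qed

end

lemma (in group) subgroup_normal_restrict:
  assumes "N \<lhd> G" "subgroup H G" "N \<subseteq> H"
  shows "N \<lhd> G\<lparr>carrier := H\<rparr>"
  using normal_restrict_supergroup[OF assms(2,1,3)] .

lemma (in group) commutator_eq_one_iff:
  assumes "x \<in> carrier G" "y \<in> carrier G"
  shows "x \<otimes> y \<otimes> inv x \<otimes> inv y = \<one> \<longleftrightarrow> x \<otimes> y = y \<otimes> x"
proof -
  have "x \<otimes> y \<otimes> inv x \<otimes> inv y = (x \<otimes> y) \<otimes> inv (y \<otimes> x)"
    using assms by (simp add: m_assoc inv_mult_group)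
  moreover have "(x \<otimes> y) \<otimes> inv (y \<otimes> x) = \<one> \<longleftrightarrow> x \<otimes> y = \<one> \<otimes> (y \<otimes> x)"
    using assms by (intro inv_solve_right') auto
  ultimately show ?thesis using assms by simp
qed

context quotient_hom
begin

lemma subgroup_cyc_ext_kernel:
  assumes fin: "finite (carrier G)" and w: "w \<in> carrier G"
  shows "subgroup (cyc_ext G N w) G"
proof -
  have "inv\<^bsub>Q\<^esub> (h w [^]\<^bsub>Q\<^esub> (i::nat)) = h w [^]\<^bsub>Q\<^esub> (i * (order G - 1))" for i
  proof (rule H.inv_equality)
    have "order G > 0" using fin w by (auto simp: order_def card_gt_0_iff)
    then have e: "i * (order G - 1) + i = order G * i" by (cases "order G") (auto simp: algebra_simps)
    have "w [^] (order G * i) = \<one>"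
      using w G.pow_order_eq_1[OF w] by (simp add: G.nat_pow_pow[symmetric])
    then have "h w [^]\<^bsub>Q\<^esub> (order G * i) = \<one>\<^bsub>Q\<^esub>"
      using w by (metis hom_nat_pow hom_one)
    then show "h w [^]\<^bsub>Q\<^esub> (i * (order G - 1)) \<otimes>\<^bsub>Q\<^esub> h w [^]\<^bsub>Q\<^esub> i = \<one>\<^bsub>Q\<^esub>"
      using w e by (simp only: H.nat_pow_mult hom_closed)
  qed (use w in auto)
  moreover have "\<exists>i::nat. \<one>\<^bsub>Q\<^esub> = h w [^]\<^bsub>Q\<^esub> i" by (rule exI[of _ 0]) simp
  moreover have "\<exists>k::nat. h w [^]\<^bsub>Q\<^esub> i \<otimes>\<^bsub>Q\<^esub> h w [^]\<^bsub>Q\<^esub> j = h w [^]\<^bsub>Q\<^esub> k" for i j :: nat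
    using w by (auto simp: H.nat_pow_mult)
  ultimately show ?thesis unfolding cyc_ext_eq[OF w]
    by unfold_locales auto
qed

lemma normal_cyc_ext_kernel:
  assumes fin: "finite (carrier G)" and w: "w \<in> carrier G"
    and comm: "\<And>g. g \<in> carrier G \<Longrightarrow> w \<otimes> g \<otimes> inv w \<otimes> inv g \<in> N"
  shows "cyc_ext G N w \<lhd> G"
proof (rule G.normal_invI)
  show "subgroup (cyc_ext G N w) G" using fin w by (rule subgroup_cyc_ext_kernel)
  fix g a assume g: "g \<in> carrier G" and a: "a \<in> cyc_ext G N w"
  obtain i :: nat where i: "h a = h w [^]\<^bsub>Q\<^esub> i" and a': "a \<in> carrier G"
    using a unfolding cyc_ext_eq[OF w] by auto
  have "h w \<otimes>\<^bsub>Q\<^esub> h g \<otimes>\<^bsub>Q\<^esub> inv\<^bsub>Q\<^esub> h w \<otimes>\<^bsub>Q\<^esub> inv\<^bsub>Q\<^esub> h g = \<one>\<^bsub>Q\<^esub>"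
    using ker[of "w \<otimes> g \<otimes> inv w \<otimes> inv g"] comm[OF g] g w by simp
  then have "h w \<otimes>\<^bsub>Q\<^esub> h g = h g \<otimes>\<^bsub>Q\<^esub> h w"
    using g w H.commutator_eq_one_iff by simp
  then have "h a \<otimes>\<^bsub>Q\<^esub> h g = h g \<otimes>\<^bsub>Q\<^esub> h a"
    using g w by (simp add: i H.group_commutes_pow)
  then have "h (g \<otimes> a \<otimes> inv g) = h a \<otimes>\<^bsub>Q\<^esub> h g \<otimes>\<^bsub>Q\<^esub> inv\<^bsub>Q\<^esub> h g" using g a' by simp
  also have "\<dots> = h w [^]\<^bsub>Q\<^esub> i" using g w by (simp add: i H.m_assoc)
  finally have *: "h (g \<otimes> a \<otimes> inv g) = h w [^]\<^bsub>Q\<^esub> i" .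
  show "g \<otimes> a \<otimes> inv g \<in> cyc_ext G N w"
    unfolding cyc_ext_eq[OF w] using g a' by (intro CollectI conjI exI[of _ i] *) simp
qed

end

lemma (in group) subgroup_cyc_ext:
  assumes "finite (carrier G)" and "N \<lhd> G" and "w \<in> carrier G"
  shows "subgroup (cyc_ext G N w) G"
proof -
  obtain Q :: "('a, 'b) monoid_scheme" and h where "quotient_hom G Q h N"
    using normal.exists_quotient_hom[OF assms(2)] .
  from quotient_hom.subgroup_cyc_ext_kernel[OF this assms(1,3)] show ?thesis .
qed

lemma (in group) normal_cyc_ext:
  assumes "finite (carrier G)" and "N \<lhd> G" and "w \<in> carrier G"
    and "\<And>g. g \<in> carrier G \<Longrightarrow> w \<otimes> g \<otimes> inv w \<otimes> inv g \<in> N"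
  shows "cyc_ext G N w \<lhd> G"
proof -
  obtain Q :: "('a, 'b) monoid_scheme" and h where "quotient_hom G Q h N"
    using normal.exists_quotient_hom[OF assms(2)] .
  from quotient_hom.normal_cyc_ext_kernel[OF this assms(1,3,4)] show ?thesis .
qed

lemma (in group) cyc_ext_self:
  assumes "N \<lhd> G" "w \<in> carrier G" shows "w \<in> cyc_ext G N w"
  using cyc_extI[of \<one> N G w 1] subgroup.one_closed[OF normal_imp_subgroup[OF assms(1)]] assms(2)
  by simp

lemma (in group) subset_cyc_ext:
  assumes "N \<lhd> G" shows "N \<subseteq> cyc_ext G N w"
proof
  fix c assume "c \<in> N"
  then show "c \<in> cyc_ext G N w"
    using cyc_extI[of c N G w 0] subgroup.mem_carrier[OF normal_imp_subgroup[OF assms(1)]] by simp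
qed

lemma (in group) cyc_ext_pow_subset:
  assumes "w \<in> carrier G" shows "cyc_ext G N (w [^] (n::nat)) \<subseteq> cyc_ext G N w"
proof
  fix g assume "g \<in> cyc_ext G N (w [^] n)"
  then obtain i :: nat and c where "c \<in> N" "g = (w [^] n) [^] i \<otimes> c" by (rule cyc_extE)
  then show "g \<in> cyc_ext G N w" using assms cyc_extI[of c N G w "n * i"] by (simp add: nat_pow_pow)
qed

lemma (in group) cyc_ext_of_member:
  assumes "N \<lhd> G" "w \<in> N"
  shows "cyc_ext G N w = N"
proof
  interpret normal N G by fact
  show "cyc_ext G N w \<subseteq> N"
  proof
    fix g assume "g \<in> cyc_ext G N w"
    then show "g \<in> N" using assms(2) by (elim cyc_extE) (simp add: subgroup_nat_pow_closed)
  qed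
qed (rule subset_cyc_ext[OF assms(1)])

section \<open>Finite p-groups\<close>

locale p_group = group +
  fixes p :: nat
  assumes prime: "Factorial_Ring.prime p"
    and finite_carrier: "finite (carrier G)"
    and order_eq_power: "\<exists>n. order G = p ^ n"

lemma finite_p_group_iff: 
  "Factorial_Ring.prime p \<Longrightarrow> finite_p_group p G \<longleftrightarrow> p_group G p"
  by (auto simp: finite_p_group_def p_group_def p_group_axioms_def)

context p_group
begin

lemma p_gt_1: "p > 1" using prime prime_gt_1_nat by blast

lemma p_group_subgroup:
  assumes "subgroup H G" shows "p_group (G\<lparr>carrier := H\<rparr>) p"
proof -
  have "card H dvd order G" using lagrange[OF assms] by (metis dvd_triv_right)
  then have "\<exists>n. card H = p ^ n" using order_eq_power divides_primepow_nat[OF prime] by metis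
  moreover have "finite H" using finite_carrier assms subgroup.subset finite_subset by blast
  ultimately show ?thesis
    unfolding p_group_def p_group_axioms_def order_def
    using prime subgroup_imp_group[OF assms] by simp
qed

lemma p_group_quotient:
  assumes "quotient_hom G Q h N" shows "p_group Q p"
proof -
  interpret quotient_hom G Q h N by fact
  have "order Q dvd order G" using order_eq by simp
  then have "\<exists>n. order Q = p ^ n" using order_eq_power divides_primepow_nat[OF prime] by metis
  moreover have "finite (carrier Q)" using finite_carrier unfolding surj[symmetric] by (rule finite_imageI)
  ultimately show ?thesis
    unfolding p_group_def p_group_axioms_def using prime H.group_axioms by simp
qed

lemma ord_eq_power:
  assumes "x \<in> carrier G" shows "\<exists>n. ord x = p ^ n"
  using ord_dvd_group_order[OF assms] order_eq_power divides_primepow_nat[OF prime] by metis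

lemma card_subgroup_eq_power:
  assumes "subgroup H G" shows "\<exists>n. card H = p ^ n"
  using p_group.order_eq_power[OF p_group_subgroup[OF assms]] by (simp add: order_def)

lemma p_dvd_card_subgroup:
  assumes "subgroup H G" "H \<noteq> {\<one>}" shows "p dvd card H"
proof -
  obtain n where n: "card H = p ^ n" using card_subgroup_eq_power[OF assms(1)] by blast
  have "n \<noteq> 0"
  proof
    assume "n = 0"
    then obtain x where "H = {x}" using n card_1_singletonE by auto
    then show False using assms subgroup.one_closed[OF assms(1)] by simp
  qed
  then show ?thesis using n by (simp add: dvd_power)
qed

text \<open>\<open>G\<close> acts on \<open>N\<close> by conjugation and the orbits have \<open>p\<close>-power size, so the number of fixed points is
  divisible by \<open>p\<close>; as \<open>\<one>\<close> is one of them, there is another.\<close>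

lemma normal_meets_center:
  assumes N: "N \<lhd> G" and nontriv: "N \<noteq> {\<one>}"
  shows "\<exists>z\<in>N. z \<noteq> \<one> \<and> (\<forall>g\<in>carrier G. g \<otimes> z = z \<otimes> g)"
proof -
  interpret N: normal N G by fact
  define conj where "conj = (\<lambda>g. \<lambda>h \<in> carrier G. g \<otimes> h \<otimes> inv g)"
  interpret act: group_action G "carrier G" conj
    unfolding conj_def by (rule action_by_conjugation)
  have orbit: "orbit G conj x = {g \<otimes> x \<otimes> inv g | g. g \<in> carrier G}" if "x \<in> carrier G" for x
    using that by (simp add: orbit_def conj_def)
  let ?O = "orbit G conj ` N"
  have disj: "A \<inter> B = {}" if XY: "A \<in> ?O" "B \<in> ?O" "A \<noteq> B" for A B
  proof -
    have "partition (carrier G) (orbits G (carrier G) conj)" by (rule act.orbit_partition)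
    moreover have "A \<in> orbits G (carrier G) conj" "B \<in> orbits G (carrier G) conj"
      using XY by (auto simp: orbits_def)
    ultimately show ?thesis
      using XY(3) act.disjoint_union by blast
  qed
  have "\<Union>?O = N"
  proof
    show "\<Union>?O \<subseteq> N" using N.inv_op_closed2 by (auto simp: orbit)
    show "N \<subseteq> \<Union>?O" using act.orbit_refl by auto
  qed
  have finN: "finite N" using finite_carrier N.subset finite_subset by blast
  have fin: "finite A" if "A \<in> ?O" for A
    using Union_upper[OF that] finN unfolding \<open>\<Union>?O = N\<close> by (rule finite_subset)
  have card_sum: "card (\<Union>?O) = (\<Sum>A\<in>?O. card A)"
  proof (rule card_Union_disjoint)
    show "pairwise disjnt ?O" unfolding pairwise_def disjnt_def using disj by blast
  qed (rule fin)
  show ?thesis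
  proof (rule ccontr)
    assume no: "\<not> ?thesis"
    have "p dvd card A" if A: "A \<in> ?O - {{\<one>}}" for A
    proof -
      obtain x where x: "x \<in> N" "A = orbit G conj x" using A by auto
      have "card A dvd order G" using act.orbit_stabilizer_theorem[of x] x by (metis N.mem_carrier dvd_triv_left)
      then obtain i where i: "card A = p ^ i" using order_eq_power divides_primepow_nat[OF prime] by metis
      have "i \<noteq> 0"
      proof
        assume "i = 0"
        then obtain y where "A = {y}" using i card_1_singletonE by auto
        moreover have "x \<in> A" using x act.orbit_refl by auto
        ultimately have A': "A = {x}" by auto
        have "g \<otimes> x = x \<otimes> g" if g: "g \<in> carrier G" for g
        proof -
          have "g \<otimes> x \<otimes> inv g \<in> A" using x g by (auto simp: orbit)
          then have "g \<otimes> x \<otimes> inv g = x" using A' by simp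
          then show ?thesis using g x by (metis N.mem_carrier inv_solve_right' m_closed)
        qed
        then have "x = \<one>" using no x by blast
        then show False using A A' by simp
      qed
      then show ?thesis using i by (simp add: dvd_power)
    qed
    then have "p dvd (\<Sum>A\<in>?O - {{\<one>}}. card A)" by (rule dvd_sum)
    moreover have "{\<one>} \<in> ?O"
    proof -
      have "orbit G conj \<one> = {\<one>}" using orbit[of \<one>] by (auto intro!: exI[of _ \<one>])
      then show ?thesis using N.one_closed by (metis image_eqI)
    qed
    then have "card N = 1 + (\<Sum>A\<in>?O - {{\<one>}}. card A)"
      using card_sum finN unfolding \<open>\<Union>?O = N\<close> by (subst (asm) sum.remove[of _ "{\<one>}"]) auto
    moreover have "p dvd card N" using p_dvd_card_subgroup N.subgroup_axioms nontriv by blast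
    ultimately have "p dvd 1" by (metis dvd_add_left_iff)
    then show False using p_gt_1 by simp
  qed
qed

text \<open>\<open>N\<close> is trivial or of order \<open>p\<close>; in the second case it is generated by any nontrivial central element
  in it. Below, powers are shown to be central in this way, by bounding the order of a normal
  subgroup that consists of powers.\<close>

lemma normal_small_central:
  assumes N: "N \<lhd> G" and card: "card N \<le> p" and z: "z \<in> N" and g: "g \<in> carrier G"
  shows "g \<otimes> z = z \<otimes> g"
proof (cases "N = {\<one>}")
  case True then show ?thesis using z g by simp
next
  case False
  interpret N: normal N G by fact
  obtain y where y: "y \<in> N" "y \<noteq> \<one>" "\<forall>g\<in>carrier G. g \<otimes> y = y \<otimes> g"
    using normal_meets_center[OF N False] by blast
  have sub: "generate G {y} \<subseteq> N" using y(1) by (intro generate_subgroup_incl N.subgroup_axioms) simp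
  have finN: "finite N" using finite_carrier N.subset finite_subset by blast
  have "generate G {y} \<noteq> {\<one>}" using y(2) generate.incl[of y "{y}" G] by auto
  then have "p dvd card (generate G {y})"
    using y(1) by (intro p_dvd_card_subgroup generate_is_subgroup) auto
  moreover have "card (generate G {y}) > 0" using finite_subset[OF sub finN] generate.one[of G "{y}"]
    unfolding card_gt_0_iff by blast
  ultimately have "card N \<le> card (generate G {y})" using card dvd_imp_le le_trans by metis
  then have gen: "generate G {y} = N" using card_seteq[OF finN sub] by simp
  obtain k :: nat where "z = y [^] k"
    using z ord_ge_1[OF finite_carrier, of y] generate_pow_nat[of y] y(1) unfolding gen by auto
  moreover have "y \<otimes> g = g \<otimes> y" using y(3) g by simp
  ultimately show ?thesis using y(1) g group_commutes_pow[of y g k] by simp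
qed

lemma central_subgroup_order_p:
  assumes "carrier G \<noteq> {\<one>}"
  shows "\<exists>z\<in>carrier G. z \<noteq> \<one> \<and> z [^] p = \<one> \<and> (\<forall>g\<in>carrier G. g \<otimes> z = z \<otimes> g)"
proof -
  have "carrier G \<lhd> G" by (rule normal_invI[OF subgroup_self]) auto
  then obtain y where y: "y \<in> carrier G" "y \<noteq> \<one>" "\<forall>g\<in>carrier G. g \<otimes> y = y \<otimes> g"
    using normal_meets_center[OF _ assms] by blast
  obtain n where n: "ord y = p ^ n" using ord_eq_power y by blast
  have "n \<noteq> 0" using n y ord_eq_1 by fastforce
  then have n': "p ^ n = p ^ (n - 1) * p" by (cases n) auto
  show ?thesis
  proof (intro bexI[of _ "y [^] (p ^ (n - 1))"] conjI ballI)
    show "y [^] p ^ (n - 1) \<noteq> \<one>"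
    proof
      assume "y [^] p ^ (n - 1) = \<one>"
      then have "p ^ n dvd p ^ (n - 1)" using pow_eq_id y n by metis
      then have "n \<le> n - 1" using p_gt_1 power_dvd_imp_le by blast
      then show False using \<open>n \<noteq> 0\<close> by simp
    qed
    show "(y [^] p ^ (n - 1)) [^] p = \<one>" using y n n' pow_ord_eq_1[of y] by (simp add: nat_pow_pow)
    show "g \<otimes> y [^] p ^ (n - 1) = y [^] p ^ (n - 1) \<otimes> g" if "g \<in> carrier G" for g
      using y that group_commutes_pow[of y g "p ^ (n - 1)"] by simp
  qed (use y in auto)
qed

end

lemma (in group) pow_cong:
  assumes x: "x \<in> carrier G" "x [^] (p::nat) = \<one>" and "a mod p = b mod p"
  shows "x [^] a = x [^] b"
proof -
  have red: "x [^] a = x [^] (a mod p)" for a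
  proof -
    have "x [^] a = x [^] (p * (a div p) + a mod p)" by simp
    also have "\<dots> = x [^] (p * (a div p)) \<otimes> x [^] (a mod p)" using x by (simp only: nat_pow_mult)
    also have "x [^] (p * (a div p)) = \<one>" using x by (simp add: nat_pow_pow[symmetric])
    finally show ?thesis using x by simp
  qed
  show ?thesis using assms(3) red[of a] red[of b] by simp
qed

lemma (in group) cyc_ext_one: "w \<in> carrier G \<Longrightarrow> cyc_ext G {\<one>} w = range (\<lambda>i::nat. w [^] i)"
  unfolding cyc_ext_def by auto

lemma (in quotient_hom) order_less:
  assumes fin: "finite (carrier G)" and z: "z \<in> N" "z \<noteq> \<one>"
  shows "order Q < order G"
proof -
  interpret N: normal N G by (rule normal_N)
  have finN: "finite N" using fin N.subset finite_subset by blast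
  have "card {z, \<one>} \<le> card N" using finN z by (intro card_mono) auto
  then have "2 \<le> card N" using z by simp
  moreover have "order Q > 0"
    using finite_imageI[OF fin, of h] H.one_closed unfolding surj order_def card_gt_0_iff by blast
  ultimately show ?thesis
    using n_less_n_mult_m[of "order Q" "card N"] by (simp add: order_eq)
qed

lemma (in group) subset_imp_cyc_ext_subset:
  assumes "subgroup H G" "N \<subseteq> H" "w \<in> H"
  shows "cyc_ext G N w \<subseteq> H"
proof
  interpret subgroup H G by fact
  fix g assume "g \<in> cyc_ext G N w"
  then obtain i :: nat and c where "c \<in> N" "g = w [^] i \<otimes> c" by (rule cyc_extE)
  then show "g \<in> H" using assms by (auto simp: subgroup_nat_pow_closed)
qed

lemma (in group) normal_cyc_ext_central:
  assumes fin: "finite (carrier G)" and z: "z \<in> carrier G"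
    and central: "\<forall>g\<in>carrier G. g \<otimes> z = z \<otimes> g"
  shows "cyc_ext G {\<one>} z \<lhd> G"
  using fin one_is_normal z
proof (rule normal_cyc_ext)
  fix g assume "g \<in> carrier G"
  then show "z \<otimes> g \<otimes> inv z \<otimes> inv g \<in> {\<one>}"
    using z central commutator_eq_one_iff by simp
qed

text \<open>Every maximal subgroup of a finite \<open>p\<close>-group is normal of index \<open>p\<close>. Divide by a central subgroup
  \<open>Z\<close> of order \<open>p\<close>: if \<open>U Z\<close> is still proper, pull back what exists in \<open>G / Z\<close>; if \<open>U Z = G\<close>, then \<open>U\<close> is
  normalised by itself and by the centre, so \<open>H = U\<close> works.\<close>

lemma exists_normal_subgroup_of_index_p:
  fixes G :: "('a, 'b) monoid_scheme"
  assumes "p_group G p" "subgroup U G" "U \<noteq> carrier G"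
  shows "\<exists>H t. H \<lhd> G \<and> U \<subseteq> H \<and> t \<in> carrier G \<and> t \<notin> H \<and> t [^]\<^bsub>G\<^esub> p \<in> H \<and> carrier G = cyc_ext G H t"
  using assms
proof (induction "order G" arbitrary: G U rule: less_induct)
  case less
  interpret p_group G p by fact
  interpret U: subgroup U G by fact
  have "carrier G \<noteq> {\<one>\<^bsub>G\<^esub>}" using less.prems(3) U.one_closed U.subset by auto
  then obtain z where z: "z \<in> carrier G" "z \<noteq> \<one>\<^bsub>G\<^esub>" "z [^]\<^bsub>G\<^esub> p = \<one>\<^bsub>G\<^esub>"
    and z_central: "\<And>g. g \<in> carrier G \<Longrightarrow> g \<otimes>\<^bsub>G\<^esub> z = z \<otimes>\<^bsub>G\<^esub> g"
    using central_subgroup_order_p by blast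
  define Z where "Z = cyc_ext G {\<one>\<^bsub>G\<^esub>} z"
  have Z_range: "Z = range (\<lambda>i::nat. z [^]\<^bsub>G\<^esub> i)" unfolding Z_def using z(1) by (rule cyc_ext_one)
  have Z: "Z \<lhd> G" unfolding Z_def
    using finite_carrier z(1) z_central by (intro normal_cyc_ext_central) auto
  have zZ: "z \<in> Z" unfolding Z_def using one_is_normal z(1) by (rule cyc_ext_self)
  obtain Q :: "('a, 'b) monoid_scheme" and h where "quotient_hom G Q h Z"
    using normal.exists_quotient_hom[OF Z] .
  then interpret q: quotient_hom G Q h Z .
  interpret Q: p_group Q p using q.quotient_hom_axioms by (rule p_group_quotient)
  have hU: "subgroup (h ` U) Q" using U.subgroup_axioms by (rule q.subgroup_img_is_subgroup)
  show ?case
  proof (cases "h ` U = carrier Q")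
    case False
    obtain K s where K: "K \<lhd> Q" "h ` U \<subseteq> K" and s: "s \<in> carrier Q" "s \<notin> K" "s [^]\<^bsub>Q\<^esub> p \<in> K"
      and gen: "carrier Q = cyc_ext Q K s"
      using less.hyps[OF q.order_less[OF finite_carrier zZ z(2)] Q.p_group_axioms hU False] by blast
    obtain t where t: "t \<in> carrier G" "h t = s" using q.lift[OF s(1)] .
    let ?H = "{x \<in> carrier G. h x \<in> K}"
    have H: "?H \<lhd> G" using K(1) by (rule q.normal_vimage)
    have "g \<in> cyc_ext G ?H t" if g: "g \<in> carrier G" for g
    proof -
      have "h g \<in> cyc_ext Q K s" using g unfolding gen[symmetric] by simp
      then obtain i :: nat and c where c: "c \<in> K" "h g = s [^]\<^bsub>Q\<^esub> i \<otimes>\<^bsub>Q\<^esub> c" by (rule cyc_extE)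
      let ?d = "inv\<^bsub>G\<^esub> (t [^]\<^bsub>G\<^esub> i) \<otimes>\<^bsub>G\<^esub> g"
      have cQ: "c \<in> carrier Q" using c(1) K(1) normal_imp_subgroup subgroup.mem_carrier by metis
      have "h ?d = inv\<^bsub>Q\<^esub> (s [^]\<^bsub>Q\<^esub> i) \<otimes>\<^bsub>Q\<^esub> (s [^]\<^bsub>Q\<^esub> i \<otimes>\<^bsub>Q\<^esub> c)"
        using t g c(2) by (simp add: q.hom_nat_pow)
      also have "\<dots> = c" using s(1) cQ by (simp add: q.H.m_assoc[symmetric])
      finally have "?d \<in> ?H" using t g c(1) by simp
      moreover have "g = t [^]\<^bsub>G\<^esub> i \<otimes>\<^bsub>G\<^esub> ?d" using t g by (simp add: m_assoc[symmetric])
      ultimately show ?thesis using cyc_extI[of ?d ?H G t i] by simp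
    qed
    moreover have "cyc_ext G ?H t \<subseteq> carrier G"
      using subset_imp_cyc_ext_subset[OF subgroup_self] t by simp
    ultimately have "carrier G = cyc_ext G ?H t" by blast
    moreover have "t [^]\<^bsub>G\<^esub> p \<in> ?H" using t s(3) by (simp add: q.hom_nat_pow)
    moreover have "U \<subseteq> ?H" using K(2) by auto
    moreover have "t \<notin> ?H" using t s(2) by simp
    ultimately show ?thesis using H t(1) by blast
  next
    case True
    have decomp: "\<exists>u\<in>U. \<exists>i::nat. g = z [^]\<^bsub>G\<^esub> i \<otimes>\<^bsub>G\<^esub> u" if g: "g \<in> carrier G" for g
    proof -
      have "h g \<in> h ` U" using g True by simp
      then obtain u where u: "u \<in> U" "h g = h u" by blast
      then have "h (g \<otimes>\<^bsub>G\<^esub> inv\<^bsub>G\<^esub> u) = \<one>\<^bsub>Q\<^esub>" using g by simp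
      then have "g \<otimes>\<^bsub>G\<^esub> inv\<^bsub>G\<^esub> u \<in> Z" using q.ker[of "g \<otimes>\<^bsub>G\<^esub> inv\<^bsub>G\<^esub> u"] g u(1) by simp
      then obtain i :: nat where "g \<otimes>\<^bsub>G\<^esub> inv\<^bsub>G\<^esub> u = z [^]\<^bsub>G\<^esub> i" unfolding Z_range by blast
      then have "g = z [^]\<^bsub>G\<^esub> i \<otimes>\<^bsub>G\<^esub> u" using g u(1) z(1) inv_solve_right' by simp
      then show ?thesis using u(1) by blast
    qed
    have "U \<lhd> G"
    proof (rule normal_invI[OF U.subgroup_axioms])
      fix g v assume g: "g \<in> carrier G" and v: "v \<in> U"
      obtain u and i :: nat where u: "u \<in> U" "g = z [^]\<^bsub>G\<^esub> i \<otimes>\<^bsub>G\<^esub> u" using decomp[OF g] by blast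
      have c: "u \<otimes>\<^bsub>G\<^esub> v \<otimes>\<^bsub>G\<^esub> inv\<^bsub>G\<^esub> u \<in> U" using u v by simp
      have "g \<otimes>\<^bsub>G\<^esub> v \<otimes>\<^bsub>G\<^esub> inv\<^bsub>G\<^esub> g = z [^]\<^bsub>G\<^esub> i \<otimes>\<^bsub>G\<^esub> (u \<otimes>\<^bsub>G\<^esub> v \<otimes>\<^bsub>G\<^esub> inv\<^bsub>G\<^esub> u) \<otimes>\<^bsub>G\<^esub> inv\<^bsub>G\<^esub> (z [^]\<^bsub>G\<^esub> i)"
        using u v z(1) by (simp add: m_assoc inv_mult_group)
      also have "z [^]\<^bsub>G\<^esub> i \<otimes>\<^bsub>G\<^esub> (u \<otimes>\<^bsub>G\<^esub> v \<otimes>\<^bsub>G\<^esub> inv\<^bsub>G\<^esub> u) = (u \<otimes>\<^bsub>G\<^esub> v \<otimes>\<^bsub>G\<^esub> inv\<^bsub>G\<^esub> u) \<otimes>\<^bsub>G\<^esub> z [^]\<^bsub>G\<^esub> i"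
        using c z_central z(1) by (intro group_commutes_pow) auto
      also have "(u \<otimes>\<^bsub>G\<^esub> v \<otimes>\<^bsub>G\<^esub> inv\<^bsub>G\<^esub> u) \<otimes>\<^bsub>G\<^esub> z [^]\<^bsub>G\<^esub> i \<otimes>\<^bsub>G\<^esub> inv\<^bsub>G\<^esub> (z [^]\<^bsub>G\<^esub> i) = u \<otimes>\<^bsub>G\<^esub> v \<otimes>\<^bsub>G\<^esub> inv\<^bsub>G\<^esub> u"
        using u v z(1) by (simp add: m_assoc)
      finally show "g \<otimes>\<^bsub>G\<^esub> v \<otimes>\<^bsub>G\<^esub> inv\<^bsub>G\<^esub> g \<in> U" using c by simp
    qed
    moreover have gen: "carrier G = cyc_ext G U z"
    proof
      show "carrier G \<subseteq> cyc_ext G U z" using decomp cyc_extI[of _ U G z] by blast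
      show "cyc_ext G U z \<subseteq> carrier G" using subset_imp_cyc_ext_subset[OF subgroup_self U.subset z(1)] .
    qed
    moreover have "z \<notin> U" using cyc_ext_of_member[OF \<open>U \<lhd> G\<close>] gen less.prems(3) by metis
    ultimately show ?thesis using z by (intro exI[of _ U] exI[of _ z]) simp
  qed
qed

section \<open>The number of powers\<close>

locale power_closed_p_group = p_group +
  assumes power_closed: "power_closed p G"
begin

lemma power_closed_p_group_subgroup:
  "subgroup H G \<Longrightarrow> power_closed_p_group (G\<lparr>carrier := H\<rparr>) p"
  using p_group_subgroup power_closed_subgroup[OF group_axioms power_closed]
  by (simp add: power_closed_p_group_def power_closed_p_group_axioms_def)

lemma power_closed_p_group_quotient:
  assumes "quotient_hom G Q h N" shows "power_closed_p_group Q p"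
  using p_group_quotient[OF assms] quotient_hom.power_closed_image[OF assms power_closed]
  by (simp add: power_closed_p_group_def power_closed_p_group_axioms_def)

lemma carrier_normal: "carrier G \<lhd> G"
  by (rule normal_invI[OF subgroup_self]) simp

lemma power_image_normal:
  assumes "N \<lhd> G" shows "(\<lambda>x. x [^] (p ^ m :: nat)) ` N \<lhd> G"
proof (rule normal_invI)
  let ?P = "(\<lambda>x. x [^] (p ^ m :: nat)) ` N"
  interpret N: normal N G by fact
  have closed: "power_closed p (G\<lparr>carrier := N\<rparr>)"
    using power_closed_subgroup[OF group_axioms power_closed N.subgroup_axioms] .
  show "subgroup ?P G"
  proof (rule subgroupI)
    show "?P \<subseteq> carrier G" by (rule image_subsetI) simp
    show "?P \<noteq> {}" using N.one_closed by blast
  next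
    fix x assume "x \<in> ?P"
    then obtain a where "a \<in> N" "x = a [^] (p ^ m :: nat)" by blast
    then have "inv a \<in> N" "inv x = inv a [^] (p ^ m :: nat)" by (simp_all add: nat_pow_inv)
    then show "inv x \<in> ?P" by blast
  next
    fix x y assume "x \<in> ?P" "y \<in> ?P"
    then obtain a b where ab: "a \<in> N" "x = a [^] (p ^ m :: nat)" "b \<in> N" "y = b [^] (p ^ m :: nat)"
      by blast
    obtain c where "c \<in> N" "a [^] (p ^ m :: nat) \<otimes> b [^] (p ^ m :: nat) = c [^] (p ^ m :: nat)"
      using power_closed_product_of_powers[OF subgroup_imp_group[OF N.subgroup_axioms] closed, of a b m] ab(1,3)
      by auto
    then show "x \<otimes> y \<in> ?P" unfolding ab(2,4) by blast
  qed
  fix g x assume g: "g \<in> carrier G" and "x \<in> ?P"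
  then obtain a where a: "a \<in> N" "x = a [^] (p ^ m :: nat)" by blast
  have "(g \<otimes> a \<otimes> inv g) [^] n = g \<otimes> a [^] n \<otimes> inv g" for n :: nat
  proof (induction n)
    case (Suc n)
    have cancel: "inv g \<otimes> (g \<otimes> y) = y" if "y \<in> carrier G" for y
      using g that by (simp add: m_assoc[symmetric])
    have "(g \<otimes> a \<otimes> inv g) [^] Suc n = (g \<otimes> a [^] n \<otimes> inv g) \<otimes> (g \<otimes> a \<otimes> inv g)"
      by (simp only: nat_pow_Suc Suc)
    then show ?case using g a(1) by (simp add: m_assoc cancel)
  qed (use g in simp)
  then have "g \<otimes> x \<otimes> inv g = (g \<otimes> a \<otimes> inv g) [^] (p ^ m :: nat)" using a by simp
  moreover have "g \<otimes> a \<otimes> inv g \<in> N" using N.inv_op_closed2[OF g a(1)] .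
  ultimately show "g \<otimes> x \<otimes> inv g \<in> ?P" by blast
qed

end

text \<open>Division by \<open>i\<close> in the field of \<open>p\<close> elements.\<close>

lemma exists_quotient_mod:
  fixes i j p :: nat
  assumes p: "Factorial_Ring.prime p" and i: "\<not> p dvd i"
  shows "\<exists>l<p. (l * i) mod p = j mod p"
proof -
  have "coprime i p" using p i prime_imp_coprime coprime_commute by blast
  moreover have "i \<noteq> 0" using i by (metis dvd_0_right)
  ultimately obtain x y where "i * x = p * y + 1" using bezout_nat[of i p] by auto
  then have "(i * x) mod p = (1 + p * y) mod p" by simp
  then have "(i * x) mod p = 1" using prime_gt_1_nat[OF p] by (simp only: mod_mult_self2 mod_less)
  then have "(j * (i * x)) mod p = j mod p" by (metis mod_mult_right_eq mult.right_neutral)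
  moreover have "((j * x) mod p * i) mod p = (j * x * i) mod p" by (rule mod_mult_left_eq)
  ultimately have "((j * x) mod p * i) mod p = j mod p" by (simp only: ac_simps)
  moreover have "(j * x) mod p < p" using prime_gt_0_nat[OF p] by simp
  ultimately show ?thesis by blast
qed

text \<open>Let \<open>f\<close> be the power map with exponent \<open>p ^ m\<close>; the index of \<open>V\<close> is \<open>1\<close> or \<open>p\<close>, and \<open>1\<close> is trivial. If \<open>G\<close> is
  generated by \<open>u\<close>, then the image of \<open>f\<close> is generated by \<open>f u\<close>, whose \<open>p\<close>-th power is \<open>f (u ^ p) = \<one>\<close>. Otherwise a second normal subgroup \<open>H\<close> of index \<open>p\<close>
  contains \<open>u\<close>, and with \<open>D = V \<inter> H\<close> the quotient \<open>G / D\<close> is elementary abelian of order \<open>p\<^sup>2\<close>. Its \<open>p + 1\<close>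
  subgroups of order \<open>p\<close> give a covering of \<open>G\<close> by \<open>V\<close> and \<open>p\<close> further subgroups, each of which meets
  \<open>V\<close> in \<open>D\<close> and therefore has at most \<open>p - 1\<close> nontrivial \<open>f\<close>-values by induction. Hence \<open>f\<close> has at most
  \<open>1 + p (p - 1) < p\<^sup>2\<close> values; since \<open>G\<close> is power-closed they form a subgroup, whose order is a
  power of \<open>p\<close>, and so there are at most \<open>p\<close> of them.\<close>

theorem card_power_image_le:
  fixes G :: "('a, 'b) monoid_scheme"
  assumes "power_closed_p_group G p"
    and "V \<lhd> G" "u \<in> carrier G" "u [^]\<^bsub>G\<^esub> p \<in> V" "carrier G = cyc_ext G V u"
    and "\<And>v. v \<in> V \<Longrightarrow> v [^]\<^bsub>G\<^esub> (p ^ m :: nat) = \<one>\<^bsub>G\<^esub>"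
  shows "card ((\<lambda>x. x [^]\<^bsub>G\<^esub> (p ^ m :: nat)) ` carrier G) \<le> p"
  using assms
proof (induction "order G" arbitrary: G V u rule: less_induct)
  case less
  interpret power_closed_p_group G p by fact
  interpret V: normal V G by fact
  note u = \<open>u \<in> carrier G\<close> and up = \<open>u [^]\<^bsub>G\<^esub> p \<in> V\<close> and gen = \<open>carrier G = cyc_ext G V u\<close>
  let ?f = "\<lambda>x. x [^]\<^bsub>G\<^esub> (p ^ m :: nat)"
  have fV: "?f v = \<one>\<^bsub>G\<^esub>" if "v \<in> V" for v using less.prems(6) that .
  have p1: "1 < p" by (rule p_gt_1)
  consider "u \<in> V" | "u \<notin> V" "cyc_ext G {\<one>\<^bsub>G\<^esub>} u = carrier G" | "u \<notin> V" "cyc_ext G {\<one>\<^bsub>G\<^esub>} u \<noteq> carrier G"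
    by blast
  then show ?case
  proof cases
    case 1
    then have "carrier G = V" using gen cyc_ext_of_member[OF V.normal_axioms] by simp
    then have "?f ` carrier G \<subseteq> {\<one>\<^bsub>G\<^esub>}" using fV by auto
    then have "card (?f ` carrier G) \<le> card {\<one>\<^bsub>G\<^esub>}" by (intro card_mono) auto
    then show ?thesis using p1 by simp
  next
    case 2
    have fu: "?f u [^]\<^bsub>G\<^esub> p = \<one>\<^bsub>G\<^esub>"
    proof -
      have "?f u [^]\<^bsub>G\<^esub> p = ?f (u [^]\<^bsub>G\<^esub> p)" using u by (simp add: nat_pow_pow mult.commute)
      then show ?thesis using fV up by simp
    qed
    have "?f ` carrier G \<subseteq> (\<lambda>i. ?f u [^]\<^bsub>G\<^esub> i) ` {..<p}"
    proof
      fix y assume "y \<in> ?f ` carrier G"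
      then obtain i :: nat where "y = ?f (u [^]\<^bsub>G\<^esub> i)" unfolding 2(2)[symmetric] cyc_ext_one[OF u] by blast
      then have "y = ?f u [^]\<^bsub>G\<^esub> i" using u by (simp add: nat_pow_pow mult.commute)
      also have "\<dots> = ?f u [^]\<^bsub>G\<^esub> (i mod p)" using u fu by (intro pow_cong) auto
      finally show "y \<in> (\<lambda>i. ?f u [^]\<^bsub>G\<^esub> i) ` {..<p}" using p1 by simp
    qed
    then have "card (?f ` carrier G) \<le> card ((\<lambda>i. ?f u [^]\<^bsub>G\<^esub> i) ` {..<p})" by (intro card_mono) auto
    also have "\<dots> \<le> p" using card_image_le[of "{..<p}"] by fastforce
    finally show ?thesis .
  next
    case 3
    have "subgroup (cyc_ext G {\<one>\<^bsub>G\<^esub>} u) G"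
      using finite_carrier one_is_normal u by (rule subgroup_cyc_ext)
    then obtain H t0 where H: "H \<lhd> G" and uH: "cyc_ext G {\<one>\<^bsub>G\<^esub>} u \<subseteq> H"
      and t0: "t0 \<in> carrier G" "t0 \<notin> H" "t0 [^]\<^bsub>G\<^esub> p \<in> H" and genH: "carrier G = cyc_ext G H t0"
      using exists_normal_subgroup_of_index_p[OF p_group_axioms _ 3(2)] by blast
    interpret H: normal H G by fact
    have uH: "u \<in> H" using uH cyc_ext_self[OF one_is_normal u] by blast
    have "\<not> V \<subseteq> H"
    proof
      assume "V \<subseteq> H"
      then have "carrier G \<subseteq> H" unfolding gen
        using subset_imp_cyc_ext_subset[OF H.subgroup_axioms _ uH] by blast
      then show False using t0 by blast
    qed
    then obtain t where t: "t \<in> V" "t \<notin> H" by blast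
    obtain Q :: "('a, 'b) monoid_scheme" and h where q: "quotient_hom G Q h V" using V.exists_quotient_hom .
    obtain R :: "('a, 'b) monoid_scheme" and k where r: "quotient_hom G R k H" using H.exists_quotient_hom .
    interpret q: quotient_hom G Q h V by (rule q)
    interpret r: quotient_hom G R k H by (rule r)
    define \<upsilon> where "\<upsilon> = h u"
    define \<tau> where "\<tau> = k t"
    have \<upsilon>: "\<upsilon> \<in> carrier Q" "\<upsilon> \<noteq> \<one>\<^bsub>Q\<^esub>" "\<upsilon> [^]\<^bsub>Q\<^esub> p = \<one>\<^bsub>Q\<^esub>"
      using u up q.ker 3(1) by (auto simp: \<upsilon>_def q.hom_nat_pow[symmetric])
    have ht: "h t = \<one>\<^bsub>Q\<^esub>" and ku: "k u = \<one>\<^bsub>R\<^esub>" using q.ker r.ker t uH u by auto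
    have \<tau>: "\<tau> \<in> carrier R" "\<tau> \<noteq> \<one>\<^bsub>R\<^esub>" using t r.ker by (auto simp: \<tau>_def)
    have k_t0: "k t0 \<in> carrier R" "k t0 [^]\<^bsub>R\<^esub> p = \<one>\<^bsub>R\<^esub>"
      using t0 r.ker by (auto simp: r.hom_nat_pow[symmetric])
    have k_pow_t0: "\<exists>j::nat. k g = k t0 [^]\<^bsub>R\<^esub> j" if "g \<in> carrier G" for g
    proof -
      have "g \<in> cyc_ext G H t0" using that genH by simp
      then show ?thesis using r.cyc_ext_eq[OF t0(1)] by simp
    qed
    \<comment> \<open>The generator of \<open>G / H\<close> may be taken from \<open>V\<close>: \<open>t\<close> is nontrivial in a group of order \<open>p\<close>.\<close>
    obtain i0 :: nat where i0: "\<tau> = k t0 [^]\<^bsub>R\<^esub> i0" using k_pow_t0[OF V.mem_carrier[OF t(1)]] unfolding \<tau>_def by (elim exE)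
    have \<tau>p: "\<tau> [^]\<^bsub>R\<^esub> p = \<one>\<^bsub>R\<^esub>"
    proof -
      have "\<tau> [^]\<^bsub>R\<^esub> p = (k t0 [^]\<^bsub>R\<^esub> p) [^]\<^bsub>R\<^esub> i0"
        using k_t0(1) by (simp add: i0 r.H.nat_pow_pow mult.commute)
      then show ?thesis using k_t0 by simp
    qed
    have i0_p: "\<not> p dvd i0"
    proof
      assume "p dvd i0"
      then obtain a where "i0 = p * a" by blast
      then have "\<tau> = \<one>\<^bsub>R\<^esub>" using k_t0 by (simp add: i0 r.H.nat_pow_pow[symmetric])
      then show False using \<tau>(2) by simp
    qed
    have k_pow: "\<exists>j::nat. k g = \<tau> [^]\<^bsub>R\<^esub> j" if g: "g \<in> carrier G" for g
    proof -
      obtain j :: nat where j: "k g = k t0 [^]\<^bsub>R\<^esub> j" using k_pow_t0[OF g] by (elim exE)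
      obtain l where l: "(l * i0) mod p = j mod p" using exists_quotient_mod[OF prime i0_p] by blast
      have "\<tau> [^]\<^bsub>R\<^esub> l = k t0 [^]\<^bsub>R\<^esub> (l * i0)" using k_t0 by (simp add: i0 r.H.nat_pow_pow mult.commute)
      also have "\<dots> = k t0 [^]\<^bsub>R\<^esub> j" using k_t0 l by (intro r.H.pow_cong)
      finally show ?thesis using j by metis
    qed
    have h_pow: "\<exists>i::nat. h g = \<upsilon> [^]\<^bsub>Q\<^esub> i" if "g \<in> carrier G" for g
    proof -
      have "g \<in> cyc_ext G V u" using that gen by simp
      then show ?thesis using q.cyc_ext_eq[OF u] by (simp add: \<upsilon>_def)
    qed
    have \<upsilon>_dvd: "p dvd i" if "\<upsilon> [^]\<^bsub>Q\<^esub> (i::nat) = \<one>\<^bsub>Q\<^esub>" for i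
    proof (rule ccontr)
      assume "\<not> p dvd i"
      then obtain l where l: "(l * i) mod p = 1 mod p" using exists_quotient_mod[OF prime] by blast
      have "\<upsilon> [^]\<^bsub>Q\<^esub> (l * i) = \<upsilon> [^]\<^bsub>Q\<^esub> (1::nat)" using \<upsilon> l by (intro q.H.pow_cong)
      moreover have "\<upsilon> [^]\<^bsub>Q\<^esub> (l * i) = \<one>\<^bsub>Q\<^esub>"
        using \<upsilon> that by (simp add: mult.commute[of l] q.H.nat_pow_pow[symmetric])
      ultimately show False using \<upsilon> by simp
    qed
    define D where "D = V \<inter> H"
    have D: "D \<lhd> G" unfolding D_def using V.normal_axioms H.normal_axioms by (rule normal_subgroup_intersect)
    have D_iff: "g \<in> D \<longleftrightarrow> h g = \<one>\<^bsub>Q\<^esub> \<and> k g = \<one>\<^bsub>R\<^esub>" if "g \<in> carrier G" for g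
      using q.ker r.ker that by (simp add: D_def)
    \<comment> \<open>\<open>G / D\<close> has the basis \<open>u, t\<close>; the subgroups of order \<open>p\<close> other than \<open>V / D\<close> are generated by
      \<open>u t ^ l\<close> for \<open>l < p\<close>.\<close>
    define w where "w l = u \<otimes>\<^bsub>G\<^esub> t [^]\<^bsub>G\<^esub> (l::nat)" for l
    have w: "w l \<in> carrier G" for l using u t by (simp add: w_def)
    have hw: "h (w l) = \<upsilon>" for l using u t ht by (simp add: w_def q.hom_nat_pow \<upsilon>_def)
    have kw: "k (w l) = \<tau> [^]\<^bsub>R\<^esub> l" for l using u t ku by (simp add: w_def r.hom_nat_pow \<tau>_def)
    define L where "L l = cyc_ext G D (w l)" for l
    have L: "subgroup (L l) G" for l unfolding L_def using finite_carrier D w by (rule subgroup_cyc_ext)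
    have LsubG: "L l \<subseteq> carrier G" for l using subgroup.subset[OF L] .
    have t_notin_L: "t \<notin> L l" for l
    proof
      assume "t \<in> L l"
      then obtain i :: nat and c where c: "c \<in> D" "t = w l [^]\<^bsub>G\<^esub> i \<otimes>\<^bsub>G\<^esub> c" unfolding L_def by (rule cyc_extE)
      have cG: "c \<in> carrier G" using c(1) by (simp add: D_def)
      have "h t = \<upsilon> [^]\<^bsub>Q\<^esub> i" using arg_cong[OF c(2), of h] w cG c(1) D_iff[OF cG] \<upsilon> by (simp add: q.hom_nat_pow hw)
      then have "p dvd i" using ht \<upsilon>_dvd by simp
      then obtain a where a: "i = p * a" by blast
      have "\<tau> = (\<tau> [^]\<^bsub>R\<^esub> l) [^]\<^bsub>R\<^esub> i"
        using arg_cong[OF c(2), of k] w cG c(1) D_iff[OF cG] \<tau> by (simp add: r.hom_nat_pow kw \<tau>_def[symmetric])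
      also have "\<dots> = (\<tau> [^]\<^bsub>R\<^esub> p) [^]\<^bsub>R\<^esub> (l * a)" using \<tau> by (simp add: r.H.nat_pow_pow a ac_simps)
      also have "\<dots> = \<one>\<^bsub>R\<^esub>" by (simp add: \<tau>p)
      finally show False using \<tau> by simp
    qed
    have card_L: "card (?f ` L l) \<le> p" for l
    proof -
      have "card (L l) < card (carrier G)"
      proof (rule psubset_card_mono[OF finite_carrier])
        show "L l \<subset> carrier G" using LsubG[of l] t_notin_L[of l] V.mem_carrier[OF t(1)] by blast
      qed
      then have "order (G\<lparr>carrier := L l\<rparr>) < order G" by (simp add: order_def)
      moreover have "power_closed_p_group (G\<lparr>carrier := L l\<rparr>) p" using L by (rule power_closed_p_group_subgroup)
      moreover have "D \<lhd> G\<lparr>carrier := L l\<rparr>"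
        using D L subset_cyc_ext[OF D] unfolding L_def by (intro subgroup_normal_restrict)
      moreover have "w l [^]\<^bsub>G\<^esub> p \<in> D"
      proof -
        have "(\<tau> [^]\<^bsub>R\<^esub> l) [^]\<^bsub>R\<^esub> p = (\<tau> [^]\<^bsub>R\<^esub> p) [^]\<^bsub>R\<^esub> l" using \<tau> by (simp add: r.H.nat_pow_pow mult.commute)
        then show ?thesis using w \<upsilon> \<tau>p by (simp add: D_iff q.hom_nat_pow r.hom_nat_pow hw kw)
      qed
      moreover have "w l \<in> L l" unfolding L_def using D w by (rule cyc_ext_self)
      ultimately show ?thesis
        using less.hyps[of "G\<lparr>carrier := L l\<rparr>" D "w l"] fV by (simp add: L_def D_def)
    qed
    have cover: "?f ` carrier G \<subseteq> insert \<one>\<^bsub>G\<^esub> (\<Union>l<p. ?f ` L l - {\<one>\<^bsub>G\<^esub>})"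
    proof
      fix y assume "y \<in> ?f ` carrier G"
      then obtain g where g: "g \<in> carrier G" "y = ?f g" by blast
      obtain i :: nat where i: "h g = \<upsilon> [^]\<^bsub>Q\<^esub> i" using h_pow[OF g(1)] by (elim exE)
      obtain j :: nat where j: "k g = \<tau> [^]\<^bsub>R\<^esub> j" using k_pow[OF g(1)] by (elim exE)
      show "y \<in> insert \<one>\<^bsub>G\<^esub> (\<Union>l<p. ?f ` L l - {\<one>\<^bsub>G\<^esub>})"
      proof (cases "p dvd i")
        case True
        then obtain a where "i = p * a" by blast
        then have "h g = \<one>\<^bsub>Q\<^esub>" using i \<upsilon> by (simp add: q.H.nat_pow_pow[symmetric])
        then have "g \<in> V" using q.ker g by simp
        then show ?thesis using fV g by simp
      next
        case False
        obtain l where l: "l < p" "(l * i) mod p = j mod p" using exists_quotient_mod[OF prime False] by blast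
        have "\<tau> [^]\<^bsub>R\<^esub> (l * i) = \<tau> [^]\<^bsub>R\<^esub> j" using \<tau> \<tau>p l by (intro r.H.pow_cong)
        then have kk: "(\<tau> [^]\<^bsub>R\<^esub> l) [^]\<^bsub>R\<^esub> i = k g" using j \<tau> by (simp add: r.H.nat_pow_pow)
        let ?d = "inv\<^bsub>G\<^esub> (w l [^]\<^bsub>G\<^esub> i) \<otimes>\<^bsub>G\<^esub> g"
        have dG: "?d \<in> carrier G" using w g by simp
        have "h ?d = inv\<^bsub>Q\<^esub> (\<upsilon> [^]\<^bsub>Q\<^esub> i) \<otimes>\<^bsub>Q\<^esub> \<upsilon> [^]\<^bsub>Q\<^esub> i"
          using w g i by (simp add: q.hom_nat_pow hw)
        moreover have "k ?d = inv\<^bsub>R\<^esub> (k g) \<otimes>\<^bsub>R\<^esub> k g"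
          using w g kk by (simp add: r.hom_nat_pow kw)
        ultimately have "?d \<in> D" using D_iff[OF dG] \<upsilon> g by simp
        moreover have "g = w l [^]\<^bsub>G\<^esub> i \<otimes>\<^bsub>G\<^esub> ?d" using w g by (simp add: m_assoc[symmetric])
        ultimately have "g \<in> L l" using cyc_extI[of ?d D G "w l" i] by (simp add: L_def)
        then show ?thesis using g l by blast
      qed
    qed
    have finL: "finite (?f ` L l)" for l using LsubG finite_carrier finite_subset by blast
    have card_nontrivial: "card (?f ` L l - {\<one>\<^bsub>G\<^esub>}) \<le> p - 1" for l
    proof -
      have "\<one>\<^bsub>G\<^esub> \<in> ?f ` L l" using subgroup.one_closed[OF L] by (intro image_eqI[of _ _ "\<one>\<^bsub>G\<^esub>"]) auto
      then have "card (?f ` L l - {\<one>\<^bsub>G\<^esub>}) = card (?f ` L l) - 1" by (simp add: card_Diff_singleton)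
      then show ?thesis using card_L[of l] by simp
    qed
    let ?W = "\<Union>l<p. ?f ` L l - {\<one>\<^bsub>G\<^esub>}"
    have finW: "finite ?W" using finL by blast
    have "card ?W \<le> (\<Sum>l<p. card (?f ` L l - {\<one>\<^bsub>G\<^esub>}))" by (intro card_UN_le) simp
    also have "\<dots> \<le> (\<Sum>l<p. p - 1)" by (intro sum_mono card_nontrivial)
    also have "\<dots> = p * (p - 1)" by simp
    finally have "card ?W \<le> p * (p - 1)" .
    moreover have "card (?f ` carrier G) \<le> card (insert \<one>\<^bsub>G\<^esub> ?W)" using cover finW by (intro card_mono) auto
    moreover have "card (insert \<one>\<^bsub>G\<^esub> ?W) \<le> Suc (card ?W)" by (rule card_insert_le_m1) auto
    ultimately have "card (?f ` carrier G) \<le> Suc (p * (p - 1))" by linarith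
    also have "\<dots> < p ^ 2" using p1 by (cases p) (auto simp: power2_eq_square)
    finally have less: "card (?f ` carrier G) < p ^ 2" .
    obtain n where n: "card (?f ` carrier G) = p ^ n"
      using card_subgroup_eq_power[OF normal_imp_subgroup[OF power_image_normal[OF carrier_normal]]] by blast
    then have "n < 2" using less p1 power_less_imp_less_exp by metis
    then have "p ^ n \<le> p ^ 1" using p1 by (intro power_increasing) auto
    then show ?thesis using n by simp
  qed
qed

section \<open>Centrality of high powers\<close>

lemma (in group) mult_pow_class_two:
  assumes a: "a \<in> carrier G" and b: "b \<in> carrier G" and y: "y \<in> carrier G"
    and comm: "b \<otimes> a = a \<otimes> b \<otimes> y"
    and central: "\<And>g. g \<in> carrier G \<Longrightarrow> g \<otimes> y = y \<otimes> g"
  shows "(a \<otimes> b) [^] (n::nat) = a [^] n \<otimes> b [^] n \<otimes> y [^] (\<Sum>i<n. i)"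
proof (induction n)
  case (Suc n)
  have y_pow: "y [^] k \<otimes> g = g \<otimes> y [^] k" if "g \<in> carrier G" for k :: nat and g
    using that y central by (intro group_commutes_pow) auto
  have swap: "b [^] k \<otimes> a = a \<otimes> b [^] k \<otimes> y [^] k" for k :: nat
  proof (induction k)
    case (Suc k)
    have "b [^] Suc k \<otimes> a = b [^] k \<otimes> (b \<otimes> a)" using a b by (simp add: m_assoc)
    also have "\<dots> = (b [^] k \<otimes> a) \<otimes> (b \<otimes> y)" using a b y by (simp add: comm m_assoc)
    also have "\<dots> = a \<otimes> b [^] k \<otimes> (y [^] k \<otimes> b) \<otimes> y" using a b y by (simp add: Suc m_assoc)
    also have "\<dots> = a \<otimes> b [^] Suc k \<otimes> y [^] Suc k" using a b y y_pow[OF b] by (simp add: m_assoc)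
    finally show ?case .
  qed (use a in simp)
  let ?s = "\<Sum>i<n. i"
  have "(a \<otimes> b) [^] Suc n = a [^] n \<otimes> b [^] n \<otimes> (y [^] ?s \<otimes> (a \<otimes> b))"
    using a b y by (simp add: Suc m_assoc)
  also have "\<dots> = a [^] n \<otimes> (b [^] n \<otimes> a) \<otimes> b \<otimes> y [^] ?s"
    using a b y y_pow[of "a \<otimes> b" ?s] by (simp add: m_assoc)
  also have "\<dots> = a [^] n \<otimes> a \<otimes> b [^] n \<otimes> (y [^] n \<otimes> b) \<otimes> y [^] ?s"
    using a b y by (simp add: swap m_assoc)
  also have "\<dots> = a [^] Suc n \<otimes> b [^] Suc n \<otimes> (y [^] n \<otimes> y [^] ?s)"
    using a b y y_pow[OF b, of n] by (simp add: m_assoc)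
  finally show ?case using y by (simp add: nat_pow_mult add.commute)
qed simp

lemma sum_below_odd:
  assumes "odd (n::nat)" shows "(\<Sum>i<n. i) = n * ((n - 1) div 2)"
proof -
  obtain k where "n = 2 * k + 1" using assms by (elim oddE)
  moreover have "(\<Sum>i<2 * k + 1. i) = (2 * k + 1) * k" for k :: nat
    by (induction k) (auto simp: algebra_simps)
  ultimately show ?thesis by simp
qed

lemma (in group) mult_pow_eq_one_class_two:
  assumes "a \<in> carrier G" "b \<in> carrier G" "y \<in> carrier G" "b \<otimes> a = a \<otimes> b \<otimes> y"
    and "\<And>g. g \<in> carrier G \<Longrightarrow> g \<otimes> y = y \<otimes> g"
    and "odd (n::nat)" "a [^] n = \<one>" "b [^] n = \<one>" "y [^] n = \<one>"
  shows "(a \<otimes> b) [^] n = \<one>"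
  using mult_pow_class_two[OF assms(1-5), of n] assms(3,6-9)
  by (simp add: sum_below_odd nat_pow_pow[symmetric])

context quotient_hom
begin

lemma image_cyc_ext:
  assumes "M \<subseteq> carrier G" "w \<in> carrier G"
  shows "h ` cyc_ext G M w = cyc_ext Q (h ` M) (h w)"
proof
  show "h ` cyc_ext G M w \<subseteq> cyc_ext Q (h ` M) (h w)"
  proof
    fix y assume "y \<in> h ` cyc_ext G M w"
    then obtain g where g: "g \<in> cyc_ext G M w" "y = h g" by blast
    obtain i :: nat and c where c: "c \<in> M" "g = w [^] i \<otimes> c" using g(1) by (rule cyc_extE)
    then have "y = h w [^]\<^bsub>Q\<^esub> i \<otimes>\<^bsub>Q\<^esub> h c" using assms g(2) c by (auto simp: hom_nat_pow)
    then show "y \<in> cyc_ext Q (h ` M) (h w)" using cyc_extI[of "h c" "h ` M" Q "h w" i] c(1) by simp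
  qed
  show "cyc_ext Q (h ` M) (h w) \<subseteq> h ` cyc_ext G M w"
  proof
    fix y assume "y \<in> cyc_ext Q (h ` M) (h w)"
    then obtain i :: nat and d where d: "d \<in> h ` M" "y = h w [^]\<^bsub>Q\<^esub> i \<otimes>\<^bsub>Q\<^esub> d" by (rule cyc_extE)
    then obtain c where c: "c \<in> M" "d = h c" by blast
    have "y = h (w [^] i \<otimes> c)" using d c assms by (auto simp: hom_nat_pow)
    then show "y \<in> h ` cyc_ext G M w" using cyc_extI[of c M G w i] c(1) by blast
  qed
qed

lemma commutator_in_kernel:
  assumes gen: "carrier G = cyc_ext G N w" and w: "w \<in> carrier G" and g: "g \<in> carrier G"
  shows "w [^] (n::nat) \<otimes> g \<otimes> inv (w [^] n) \<otimes> inv g \<in> N"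
proof -
  have "g \<in> cyc_ext G N w" using g gen by simp
  then obtain i :: nat where i: "h g = h w [^]\<^bsub>Q\<^esub> i" using cyc_ext_eq[OF w] by auto
  have "h w [^]\<^bsub>Q\<^esub> n \<otimes>\<^bsub>Q\<^esub> h g = h g \<otimes>\<^bsub>Q\<^esub> h w [^]\<^bsub>Q\<^esub> n"
    using w by (simp add: i H.nat_pow_mult add.commute)
  then have "h (w [^] n \<otimes> g \<otimes> inv (w [^] n) \<otimes> inv g) = \<one>\<^bsub>Q\<^esub>"
    using w g H.commutator_eq_one_iff[of "h w [^]\<^bsub>Q\<^esub> n" "h g"] by (simp add: hom_nat_pow)
  then show ?thesis using ker[of "w [^] n \<otimes> g \<otimes> inv (w [^] n) \<otimes> inv g"] w g by simp
qed

end

lemma (in group) normal_cyc_ext_pow: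
  assumes fin: "finite (carrier G)" and M: "M \<lhd> G" and w: "w \<in> carrier G"
    and gen: "carrier G = cyc_ext G M w"
  shows "cyc_ext G M (w [^] (n::nat)) \<lhd> G"
proof -
  obtain Q :: "('a, 'b) monoid_scheme" and h where q: "quotient_hom G Q h M"
    using normal.exists_quotient_hom[OF M] .
  show ?thesis
    using fin M quotient_hom.commutator_in_kernel[OF q gen w] w by (intro normal_cyc_ext) auto
qed

text \<open>Modulo the normal subgroup of \<open>p ^ m\<close>-th powers of \<open>V\<close>, the map \<open>f\<close> is trivial on \<open>V\<close>, so that \<open>f(G)\<close> has at
  most \<open>p\<close> elements there and is central: all commutators with \<open>f(g)\<close> are \<open>p ^ m\<close>-th powers of elements
  of \<open>V\<close>.\<close>

lemma (in power_closed_p_group) power_image_commutator: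
  assumes V: "V \<lhd> G" and u: "u \<in> carrier G" "u [^] p \<in> V" and gen: "carrier G = cyc_ext G V u"
    and cardY: "card ((\<lambda>x. x [^] (p ^ m :: nat)) ` V) \<le> p"
    and g: "g \<in> carrier G" and b: "b \<in> carrier G"
  shows "\<exists>y\<in>(\<lambda>x. x [^] (p ^ m :: nat)) ` V. b \<otimes> g [^] (p ^ m :: nat) = g [^] (p ^ m :: nat) \<otimes> b \<otimes> y"
proof -
  let ?f = "\<lambda>x. x [^] (p ^ m :: nat)"
  interpret V: normal V G by fact
  have Y: "?f ` V \<lhd> G" using V by (rule power_image_normal)
  obtain Q :: "('a, 'b) monoid_scheme" and h where q: "quotient_hom G Q h (?f ` V)"
    using normal.exists_quotient_hom[OF Y] .
  interpret Q: power_closed_p_group Q p using q by (rule power_closed_p_group_quotient)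
  interpret q: quotient_hom G Q h "?f ` V" by (rule q)
  have "card ((\<lambda>x. x [^]\<^bsub>Q\<^esub> (p ^ m :: nat)) ` carrier Q) \<le> p"
  proof (rule card_power_image_le[OF Q.power_closed_p_group_axioms])
    show "h ` V \<lhd> Q" using V by (rule q.normal_image)
    show "h u \<in> carrier Q" using u by simp
    show "h u [^]\<^bsub>Q\<^esub> p \<in> h ` V" using u by (simp add: q.hom_nat_pow[symmetric])
    show "carrier Q = cyc_ext Q (h ` V) (h u)"
      using q.image_cyc_ext[OF V.subset u(1)] gen q.surj by simp
    show "v [^]\<^bsub>Q\<^esub> (p ^ m :: nat) = \<one>\<^bsub>Q\<^esub>" if "v \<in> h ` V" for v
    proof -
      obtain w where w: "w \<in> V" "v = h w" using \<open>v \<in> h ` V\<close> by blast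
      then have "?f w \<in> ?f ` V" by blast
      then have "h (?f w) = \<one>\<^bsub>Q\<^esub>" using q.ker[of "?f w"] w by simp
      then show ?thesis using w by (simp add: q.hom_nat_pow)
    qed
  qed
  then have central: "x \<otimes>\<^bsub>Q\<^esub> z = z \<otimes>\<^bsub>Q\<^esub> x"
    if "z \<in> (\<lambda>x. x [^]\<^bsub>Q\<^esub> (p ^ m :: nat)) ` carrier Q" "x \<in> carrier Q" for x z
    using Q.normal_small_central[OF Q.power_image_normal[OF Q.carrier_normal]] that by blast
  have "h b \<otimes>\<^bsub>Q\<^esub> h (?f g) = h (?f g) \<otimes>\<^bsub>Q\<^esub> h b"
    unfolding q.hom_nat_pow[OF g] using g b by (intro central imageI q.hom_closed)
  then have "h (inv (?f g \<otimes> b) \<otimes> (b \<otimes> ?f g)) = \<one>\<^bsub>Q\<^esub>" using g b by simp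
  then have "inv (?f g \<otimes> b) \<otimes> (b \<otimes> ?f g) \<in> ?f ` V"
    using q.ker[of "inv (?f g \<otimes> b) \<otimes> (b \<otimes> ?f g)"] g b by simp
  moreover have "b \<otimes> ?f g = ?f g \<otimes> b \<otimes> (inv (?f g \<otimes> b) \<otimes> (b \<otimes> ?f g))"
    using g b by (simp add: m_assoc[symmetric])
  ultimately show ?thesis by blast
qed

text \<open>The two inductions on exponents below run along this quotient, by the product \<open>L\<close> of the \<open>p ^ (m + 1)\<close>-th powers
  of \<open>G\<close> and the \<open>p ^ m\<close>-th powers of \<open>M\<close>. It brings \<open>G\<close> down to exponent \<open>p ^ (m + 1)\<close> and \<open>M\<close> down to
  \<open>p ^ m\<close>. That \<open>L\<close> consists of single products of two powers, rather than words in powers, comes from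
  power-closure.\<close>

lemma (in power_closed_p_group) exists_exponent_lowering_quotient:
  assumes M: "M \<lhd> G"
  shows "\<exists>(Q :: ('a, 'b) monoid_scheme) h L. quotient_hom G Q h L \<and>
    (\<forall>y\<in>carrier Q. y [^]\<^bsub>Q\<^esub> (p ^ Suc m :: nat) = \<one>\<^bsub>Q\<^esub>) \<and>
    (\<forall>y\<in>h ` M. y [^]\<^bsub>Q\<^esub> (p ^ m :: nat) = \<one>\<^bsub>Q\<^esub>) \<and>
    (\<forall>x\<in>L. \<exists>a\<in>carrier G. \<exists>c\<in>M. x = a [^] (p ^ Suc m :: nat) \<otimes> c [^] (p ^ m :: nat))"
proof -
  interpret M: normal M G by (rule M)
  let ?f = "\<lambda>x. x [^] (p ^ Suc m :: nat)"
  let ?g = "\<lambda>x. x [^] (p ^ m :: nat)"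
  let ?L = "?f ` carrier G <#> ?g ` M"
  have L: "?L \<lhd> G"
    using power_image_normal[OF carrier_normal] power_image_normal[OF M]
    by (rule normal_subgroup_set_mult_closed)
  have L_iff: "x \<in> ?L \<longleftrightarrow> (\<exists>a\<in>carrier G. \<exists>c\<in>M. x = ?f a \<otimes> ?g c)" for x
    unfolding set_mult_def by blast
  obtain Q :: "('a, 'b) monoid_scheme" and h where q: "quotient_hom G Q h ?L"
    using normal.exists_quotient_hom[OF L] .
  interpret q: quotient_hom G Q h ?L by (rule q)
  have "y [^]\<^bsub>Q\<^esub> (p ^ Suc m :: nat) = \<one>\<^bsub>Q\<^esub>" if "y \<in> carrier Q" for y
  proof -
    obtain a where a: "a \<in> carrier G" "h a = y" using q.lift[OF \<open>y \<in> carrier Q\<close>] .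
    have "?f a = ?f a \<otimes> ?g \<one>" using a by simp
    then have "?f a \<in> ?L" unfolding L_iff using a(1) M.one_closed by blast
    then have "h (?f a) = \<one>\<^bsub>Q\<^esub>" using q.ker[of "?f a"] a(1) by simp
    then show ?thesis using a by (simp add: q.hom_nat_pow)
  qed
  moreover have "y [^]\<^bsub>Q\<^esub> (p ^ m :: nat) = \<one>\<^bsub>Q\<^esub>" if "y \<in> h ` M" for y
  proof -
    obtain c where c: "c \<in> M" "y = h c" using \<open>y \<in> h ` M\<close> by blast
    have "?g c = ?f \<one> \<otimes> ?g c" using c by simp
    then have "?g c \<in> ?L" unfolding L_iff using c(1) one_closed by blast
    then have "h (?g c) = \<one>\<^bsub>Q\<^esub>" using q.ker[of "?g c"] c(1) by simp
    then show ?thesis using c by (simp add: q.hom_nat_pow)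
  qed
  ultimately show ?thesis using q L_iff by blast
qed

text \<open>Write \<open>f\<close> for the power map with exponent \<open>p ^ m\<close> and \<open>V\<close> for the subgroup generated by \<open>M\<close> and
  \<open>u ^ p\<close>; the claim is that \<open>f\<close> is trivial on \<open>V\<close>. For \<open>m = 0\<close> both \<open>M\<close> and \<open>u ^ p\<close> are trivial, and \<open>V = M\<close> if \<open>u\<close>
  lies in \<open>V\<close>. Otherwise \<open>V\<close> is a proper subgroup. By induction on the order, \<open>f\<close> is trivial on the subgroup of
  \<open>V\<close> generated by \<open>M\<close> and \<open>u ^ (p ^ 2)\<close>, so the values of \<open>f\<close> on \<open>V\<close> form a normal subgroup \<open>Y\<close> of order at
  most \<open>p\<close>, which is central, and all commutators with values of \<open>f\<close> lie in \<open>Y\<close> (\<open>power_image_commutator\<close>). By induction on \<open>m\<close>, applied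
  to the quotient that lowers both exponents, \<open>g ^ (p ^ (m - 1)) = f(k) c ^ (p ^ (m - 1))\<close> for
  some \<open>k\<close> in \<open>G\<close> and \<open>c\<close> in \<open>M\<close>. Both factors have order dividing \<open>p\<close>, and they commute up to an element of
  \<open>Y\<close>. For odd \<open>p\<close> the \<open>p\<close>-th power of such a product is \<open>\<one>\<close>, and it equals \<open>f(g)\<close>. In the induction
  step of the proof the exponent \<open>m\<close> of this sketch appears as \<open>Suc m\<close>.\<close>

theorem cyc_ext_pow_exponent:
  fixes G :: "('a, 'b) monoid_scheme"
  assumes "power_closed_p_group G p" "odd p"
    and "M \<lhd> G" "u \<in> carrier G" "carrier G = cyc_ext G M u"
    and "\<And>g. g \<in> carrier G \<Longrightarrow> g [^]\<^bsub>G\<^esub> (p ^ Suc m :: nat) = \<one>\<^bsub>G\<^esub>"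
    and "\<And>c. c \<in> M \<Longrightarrow> c [^]\<^bsub>G\<^esub> (p ^ m :: nat) = \<one>\<^bsub>G\<^esub>"
    and "g \<in> cyc_ext G M (u [^]\<^bsub>G\<^esub> p)"
  shows "g [^]\<^bsub>G\<^esub> (p ^ m :: nat) = \<one>\<^bsub>G\<^esub>"
  using assms(1,3-)
proof (induction m arbitrary: G M u g)
  case 0
  interpret power_closed_p_group G p by fact
  interpret M: normal M G by fact
  obtain i :: nat and c where c: "c \<in> M" and g: "g = (u [^]\<^bsub>G\<^esub> p) [^]\<^bsub>G\<^esub> i \<otimes>\<^bsub>G\<^esub> c"
    using 0(7) by (rule cyc_extE)
  have "u [^]\<^bsub>G\<^esub> p = \<one>\<^bsub>G\<^esub>" using 0(5)[of u] 0(3) by simp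
  moreover have "c = \<one>\<^bsub>G\<^esub>" using 0(6)[of c] c by simp
  ultimately show ?case using g by simp
next
  case (Suc m)
  note outer_IH = Suc.IH
  show ?case
    using Suc.prems
  proof (induction "order G" arbitrary: G M u g rule: less_induct)
    case less
    interpret power_closed_p_group G p by fact
    interpret M: normal M G by fact
    let ?f = "\<lambda>x. x [^]\<^bsub>G\<^esub> (p ^ Suc m :: nat)"
    let ?h = "\<lambda>x. x [^]\<^bsub>G\<^esub> (p ^ m :: nat)"
    note u = \<open>u \<in> carrier G\<close> and gen = \<open>carrier G = cyc_ext G M u\<close>
    have exp_G: "x [^]\<^bsub>G\<^esub> (p ^ Suc (Suc m) :: nat) = \<one>\<^bsub>G\<^esub>" if "x \<in> carrier G" for x
      using less.prems(5) that .
    have exp_M: "?f c = \<one>\<^bsub>G\<^esub>" if "c \<in> M" for c using less.prems(6) that .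
    define V where "V = cyc_ext G M (u [^]\<^bsub>G\<^esub> p)"
    have gV: "g \<in> V" using less.prems(7) by (simp add: V_def)
    have V: "V \<lhd> G" unfolding V_def using finite_carrier M.normal_axioms u gen by (rule normal_cyc_ext_pow)
    interpret V: normal V G by (rule V)
    have upV: "u [^]\<^bsub>G\<^esub> p \<in> V" unfolding V_def using M.normal_axioms u by (intro cyc_ext_self) auto
    have MV: "M \<subseteq> V" unfolding V_def using M.normal_axioms by (rule subset_cyc_ext)
    show ?case
    proof (cases "u \<in> V")
      case True
      \<comment> \<open>In the \<open>p\<close>-group \<open>G / M\<close> the image of \<open>u\<close> is a power of its own \<open>p\<close>-th power, hence trivial.\<close>
      obtain Q :: "('a, 'b) monoid_scheme" and h where q: "quotient_hom G Q h M" using M.exists_quotient_hom .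
      interpret q: quotient_hom G Q h M by (rule q)
      interpret Q: p_group Q p using q by (rule p_group_quotient)
      have "\<exists>i::nat. h u = h (u [^]\<^bsub>G\<^esub> p) [^]\<^bsub>Q\<^esub> i"
        using True u q.cyc_ext_eq[of "u [^]\<^bsub>G\<^esub> p"] unfolding V_def by simp
      then obtain i :: nat where "h u = h (u [^]\<^bsub>G\<^esub> p) [^]\<^bsub>Q\<^esub> i" by (elim exE)
      then have i: "h u = h u [^]\<^bsub>Q\<^esub> (p * i)" using u by (simp add: q.hom_nat_pow q.H.nat_pow_pow)
      have iter: "h u = h u [^]\<^bsub>Q\<^esub> ((p * i) ^ n)" for n
      proof (induction n)
        case (Suc n)
        have "h u = (h u [^]\<^bsub>Q\<^esub> ((p * i) ^ n)) [^]\<^bsub>Q\<^esub> (p * i)" using Suc i by simp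
        then show ?case using u by (simp add: q.H.nat_pow_pow ac_simps)
      qed (use u in simp)
      obtain n where "order Q = p ^ n" using Q.order_eq_power by blast
      then have "h u = (h u [^]\<^bsub>Q\<^esub> order Q) [^]\<^bsub>Q\<^esub> (i ^ n)"
        using iter[of n] u by (simp add: q.H.nat_pow_pow power_mult_distrib)
      then have "h u = \<one>\<^bsub>Q\<^esub>" using u q.H.pow_order_eq_1[of "h u"] by simp
      then have "u \<in> M" using q.ker u by simp
      then have "u [^]\<^bsub>G\<^esub> p \<in> M" by (rule M.subgroup_nat_pow_closed)
      then have "V = M" unfolding V_def using M.normal_axioms by (intro cyc_ext_of_member)
      then show ?thesis using exp_M gV by simp
    next
      case False
      have GV: "power_closed_p_group (G\<lparr>carrier := V\<rparr>) p"
        using V.subgroup_axioms by (rule power_closed_p_group_subgroup)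
      define V2 where "V2 = cyc_ext G M ((u [^]\<^bsub>G\<^esub> p) [^]\<^bsub>G\<^esub> p)"
      have V2: "V2 \<lhd> G" unfolding V2_def nat_pow_pow[OF u]
        using finite_carrier M.normal_axioms u gen by (rule normal_cyc_ext_pow)
      have V2V: "V2 \<subseteq> V" unfolding V2_def V_def using u by (intro cyc_ext_pow_subset) simp
      have "order (G\<lparr>carrier := V\<rparr>) < order G"
        unfolding order_def using False u V.subset by (auto intro!: psubset_card_mono finite_carrier)
      then have f_V2: "?f x = \<one>\<^bsub>G\<^esub>" if "x \<in> V2" for x
        using less.hyps[of "G\<lparr>carrier := V\<rparr>" M "u [^]\<^bsub>G\<^esub> p" x] that GV upV exp_M exp_G
          subgroup_normal_restrict[OF M.normal_axioms V.subgroup_axioms MV]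
        by (simp add: V2_def V_def[symmetric])
      have "V = cyc_ext G V2 (u [^]\<^bsub>G\<^esub> p)"
      proof
        have "M \<subseteq> V2" unfolding V2_def using M.normal_axioms by (rule subset_cyc_ext)
        then show "V \<subseteq> cyc_ext G V2 (u [^]\<^bsub>G\<^esub> p)" unfolding V_def cyc_ext_def by blast
        show "cyc_ext G V2 (u [^]\<^bsub>G\<^esub> p) \<subseteq> V"
          using V.subgroup_axioms V2V upV by (rule subset_imp_cyc_ext_subset)
      qed
      moreover have "(u [^]\<^bsub>G\<^esub> p) [^]\<^bsub>G\<^esub> p \<in> V2"
        unfolding V2_def using M.normal_axioms u by (intro cyc_ext_self) auto
      ultimately have cardY: "card (?f ` V) \<le> p"
        using card_power_image_le[OF GV subgroup_normal_restrict[OF V2 V.subgroup_axioms V2V], of "u [^]\<^bsub>G\<^esub> p" "Suc m"]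
          upV f_V2 by simp
      have Y: "?f ` V \<lhd> G" using V by (rule power_image_normal)
      have gen_V: "carrier G = cyc_ext G V u"
      proof
        show "carrier G \<subseteq> cyc_ext G V u" using gen MV unfolding cyc_ext_def by blast
        show "cyc_ext G V u \<subseteq> carrier G" using subgroup_self V.subset u by (rule subset_imp_cyc_ext_subset)
      qed
      obtain Q :: "('a, 'b) monoid_scheme" and q L where qq: "quotient_hom G Q q L"
        and exp_Q: "\<forall>y\<in>carrier Q. y [^]\<^bsub>Q\<^esub> (p ^ Suc m :: nat) = \<one>\<^bsub>Q\<^esub>"
        and exp_qM: "\<forall>y\<in>q ` M. y [^]\<^bsub>Q\<^esub> (p ^ m :: nat) = \<one>\<^bsub>Q\<^esub>"
        and L_products: "\<forall>x\<in>L. \<exists>a\<in>carrier G. \<exists>c\<in>M. x = ?f a \<otimes>\<^bsub>G\<^esub> ?h c"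
        using exists_exponent_lowering_quotient[OF M.normal_axioms, of m] by blast
      interpret q: quotient_hom G Q q L by (rule qq)
      have pcQ: "power_closed_p_group Q p" using qq by (rule power_closed_p_group_quotient)
      have "?h g \<in> L"
      proof -
        have qg: "q g \<in> cyc_ext Q (q ` M) (q u [^]\<^bsub>Q\<^esub> p)"
          using gV q.image_cyc_ext[OF M.subset, of "u [^]\<^bsub>G\<^esub> p"] u by (auto simp: V_def q.hom_nat_pow)
        have gen_Q: "carrier Q = cyc_ext Q (q ` M) (q u)"
          using q.image_cyc_ext[OF M.subset u] gen q.surj by simp
        have "q g [^]\<^bsub>Q\<^esub> (p ^ m :: nat) = \<one>\<^bsub>Q\<^esub>"
          using pcQ q.normal_image[OF M.normal_axioms] q.hom_closed[OF u] gen_Q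
            exp_Q[rule_format] exp_qM[rule_format] qg
          by (rule outer_IH)
        then show ?thesis using gV q.ker[of "?h g"] by (simp add: q.hom_nat_pow)
      qed
      then obtain k c where k: "k \<in> carrier G" and c: "c \<in> M" and hg: "?h g = ?f k \<otimes>\<^bsub>G\<^esub> ?h c"
        using L_products by blast
      obtain y where y: "y \<in> ?f ` V" "?h c \<otimes>\<^bsub>G\<^esub> ?f k = ?f k \<otimes>\<^bsub>G\<^esub> ?h c \<otimes>\<^bsub>G\<^esub> y"
        using power_image_commutator[OF V u upV gen_V cardY k, of "?h c"] c by auto
      obtain v where v: "v \<in> V" "y = ?f v" using y(1) by blast
      have pow_p: "?f x [^]\<^bsub>G\<^esub> p = \<one>\<^bsub>G\<^esub>" if "x \<in> carrier G" for x
        using exp_G[OF that] that by (simp add: nat_pow_pow mult.commute)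
      have "(?f k \<otimes>\<^bsub>G\<^esub> ?h c) [^]\<^bsub>G\<^esub> p = \<one>\<^bsub>G\<^esub>"
      proof (rule mult_pow_eq_one_class_two[of _ _ y])
        show "g \<otimes>\<^bsub>G\<^esub> y = y \<otimes>\<^bsub>G\<^esub> g" if "g \<in> carrier G" for g
          using normal_small_central[OF Y cardY y(1) that] .
        show "?h c [^]\<^bsub>G\<^esub> p = \<one>\<^bsub>G\<^esub>" using exp_M[OF c] c by (simp add: nat_pow_pow mult.commute)
      qed (use k c v y(2) pow_p \<open>odd p\<close> in auto)
      then have "?h g [^]\<^bsub>G\<^esub> p = \<one>\<^bsub>G\<^esub>" by (simp only: hg)
      then show ?thesis using gV by (simp add: nat_pow_pow mult.commute)
    qed
  qed
qed

text \<open>The subgroup \<open>K\<close> generated by \<open>M\<close> and \<open>u\<close> is normal in \<open>G\<close>, and its \<open>p ^ m\<close>-th powers form a normal subgroup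
  of order at most \<open>p\<close> because they are trivial on the subgroup generated by \<open>M\<close> and \<open>u ^ p\<close>. Normal subgroups of
  order at most \<open>p\<close> are central.\<close>

theorem pow_central_of_commutators_bounded:
  fixes G (structure)
  assumes G: "power_closed_p_group G p" and p: "odd p" and M: "M \<lhd> G" and u: "u \<in> carrier G"
    and comm: "\<And>g. g \<in> carrier G \<Longrightarrow> u \<otimes> g \<otimes> inv u \<otimes> inv g \<in> M"
    and exp_G: "\<And>g. g \<in> carrier G \<Longrightarrow> g [^] (p ^ Suc m :: nat) = \<one>"
    and exp_M: "\<And>c. c \<in> M \<Longrightarrow> c [^] (p ^ m :: nat) = \<one>"
    and x: "x \<in> carrier G"
  shows "x \<otimes> u [^] (p ^ m :: nat) = u [^] (p ^ m :: nat) \<otimes> x"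
proof -
  interpret power_closed_p_group G p by (rule G)
  let ?f = "\<lambda>x. x [^] (p ^ m :: nat)"
  define K where "K = cyc_ext G M u"
  have K: "K \<lhd> G" unfolding K_def using finite_carrier M u comm by (rule normal_cyc_ext)
  interpret K: normal K G by (rule K)
  have uK: "u \<in> K" unfolding K_def using M u by (rule cyc_ext_self)
  have MK: "M \<subseteq> K" unfolding K_def using M by (rule subset_cyc_ext)
  interpret GK: power_closed_p_group "G\<lparr>carrier := K\<rparr>" p
    using K.subgroup_axioms by (rule power_closed_p_group_subgroup)
  have M': "M \<lhd> G\<lparr>carrier := K\<rparr>" using M K.subgroup_axioms MK by (rule subgroup_normal_restrict)
  define V where "V = cyc_ext G M (u [^] p)"
  have V: "V \<lhd> G\<lparr>carrier := K\<rparr>"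
    using GK.normal_cyc_ext_pow[OF GK.finite_carrier M', of u p] uK by (simp add: V_def K_def)
  have VK: "V \<subseteq> K" unfolding V_def K_def using u by (rule cyc_ext_pow_subset)
  have f_V: "?f v = \<one>" if "v \<in> V" for v
    using cyc_ext_pow_exponent[OF GK.power_closed_p_group_axioms p M', of u m v] that uK exp_G exp_M
    by (simp add: V_def K_def)
  have "K = cyc_ext G V u"
  proof
    have "M \<subseteq> V" unfolding V_def using M by (rule subset_cyc_ext)
    then show "K \<subseteq> cyc_ext G V u" unfolding K_def cyc_ext_def by blast
    show "cyc_ext G V u \<subseteq> K" using K.subgroup_axioms VK uK by (rule subset_imp_cyc_ext_subset)
  qed
  moreover have "u [^] p \<in> V" unfolding V_def using M u by (intro cyc_ext_self) auto
  ultimately have "card (?f ` K) \<le> p"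
    using card_power_image_le[OF GK.power_closed_p_group_axioms V, of u m] uK f_V by simp
  then show ?thesis
    using normal_small_central[OF power_image_normal[OF K]] uK x by blast
qed

section \<open>The witness product\<close>

text \<open>The product \<open>x k ^ (n - 1) x k ^ (n - 2) \<dots> x k x\<close>. If \<open>f (x k) = x f x\<close> for all \<open>x\<close>, then
  \<open>f (x k ^ n) = witness_prod G k x n \<otimes> f x\<close>.\<close>

fun witness_prod :: "('a, 'b) monoid_scheme \<Rightarrow> 'a \<Rightarrow> 'a \<Rightarrow> nat \<Rightarrow> 'a" where
  "witness_prod G k x 0 = \<one>\<^bsub>G\<^esub>"
| "witness_prod G k x (Suc n) = x \<otimes>\<^bsub>G\<^esub> k [^]\<^bsub>G\<^esub> n \<otimes>\<^bsub>G\<^esub> witness_prod G k x n"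

lemma foldr_eq_witness_prod:
  "foldr (\<otimes>\<^bsub>G\<^esub>) (map (\<lambda>i. x \<otimes>\<^bsub>G\<^esub> k [^]\<^bsub>G\<^esub> (n - i)) [1..<Suc n]) \<one>\<^bsub>G\<^esub> = witness_prod G k x n"
proof -
  have "foldr (\<otimes>\<^bsub>G\<^esub>) (map (\<lambda>i. x \<otimes>\<^bsub>G\<^esub> k [^]\<^bsub>G\<^esub> (n - i)) [Suc (n - m)..<Suc n]) \<one>\<^bsub>G\<^esub> = witness_prod G k x m"
    if "m \<le> n" for m
    using that
  proof (induction m)
    case (Suc m)
    have "[Suc (n - Suc m)..<Suc n] = Suc (n - Suc m) # [Suc (n - m)..<Suc n]"
      using Suc.prems by (subst upt_conv_Cons) (auto simp: Suc_diff_Suc)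
    moreover have "n - Suc (n - Suc m) = m" using Suc.prems by simp
    ultimately show ?case using Suc by (simp del: upt_Suc)
  qed simp
  from this[of n] show ?thesis by (simp del: upt_Suc)
qed

lemma witnesses_iff:
  "k \<in> witnesses G \<longleftrightarrow> k \<in> carrier G \<and> group.ord G k > 0 \<and>
    (\<forall>x\<in>carrier G. witness_prod G k x (group.ord G k) = \<one>\<^bsub>G\<^esub>)"
  unfolding witnesses_def foldr_eq_witness_prod by simp

context group
begin

lemma witness_prod_closed [simp]:
  "k \<in> carrier G \<Longrightarrow> x \<in> carrier G \<Longrightarrow> witness_prod G k x n \<in> carrier G"
  by (induction n) auto

lemma witness_prod_add:
  assumes "k \<in> carrier G" "x \<in> carrier G"
  shows "witness_prod G k x (a + b) = witness_prod G k (x \<otimes> k [^] b) a \<otimes> witness_prod G k x b"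
proof (induction a)
  case (Suc a)
  have "k [^] (a + b) = k [^] b \<otimes> k [^] a" using assms by (simp add: nat_pow_mult add.commute)
  then show ?case using assms Suc by (simp add: m_assoc)
qed (use assms in simp)

lemma witness_prod_mult_central:
  assumes k: "k \<in> carrier G" and x: "x \<in> carrier G" and z: "z \<in> carrier G"
    and central: "\<And>g. g \<in> carrier G \<Longrightarrow> g \<otimes> z = z \<otimes> g"
  shows "witness_prod G k (x \<otimes> z) n = witness_prod G k x n \<otimes> z [^] n"
proof (induction n)
  case (Suc n)
  let ?w = "witness_prod G k x n"
  have "witness_prod G k (x \<otimes> z) (Suc n) = x \<otimes> (z \<otimes> (k [^] n \<otimes> (?w \<otimes> z [^] n)))"
    using k x z by (simp add: Suc m_assoc)
  also have "z \<otimes> (k [^] n \<otimes> (?w \<otimes> z [^] n)) = (k [^] n \<otimes> (?w \<otimes> z [^] n)) \<otimes> z"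
    using k x z by (intro central[symmetric]) auto
  finally show ?case using k x z by (simp add: m_assoc)
qed simp

lemma witness_prod_central:
  assumes k: "k \<in> carrier G" and x: "x \<in> carrier G"
    and central: "\<And>g. g \<in> carrier G \<Longrightarrow> g \<otimes> k = k \<otimes> g"
  shows "witness_prod G k x n = x [^] n \<otimes> k [^] (\<Sum>i<n. i)"
proof (induction n)
  case (Suc n)
  let ?s = "\<Sum>i<n. i"
  have "witness_prod G k x (Suc n) = x \<otimes> (k [^] n \<otimes> x [^] n) \<otimes> k [^] ?s"
    using k x by (simp add: Suc m_assoc)
  also have "k [^] n \<otimes> x [^] n = x [^] n \<otimes> k [^] n"
    using k x central by (intro group_commutes_pow) auto
  also have "x \<otimes> (x [^] n \<otimes> k [^] n) \<otimes> k [^] ?s = (x \<otimes> x [^] n) \<otimes> (k [^] n \<otimes> k [^] ?s)" using k x by (simp add: m_assoc)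
  also have "x \<otimes> x [^] n = x [^] Suc n" using x by (rule nat_pow_Suc2[symmetric])
  finally show ?case using k by (simp add: nat_pow_mult add.commute)
qed simp

end

lemma (in group_hom) hom_witness_prod:
  "k \<in> carrier G \<Longrightarrow> x \<in> carrier G \<Longrightarrow> h (witness_prod G k x n) = witness_prod H (h k) (h x) n"
  by (induction n) (simp_all add: hom_nat_pow)

text \<open>Inside the subgroup generated by \<open>M\<close> and \<open>a\<close> the quotient by \<open>M\<close> is cyclic, so there the element \<open>a\<close> has all its
  commutators in \<open>M\<close>.\<close>

lemma (in power_closed_p_group) pow_commutes_with_bounded_normal:
  assumes p: "odd p" and M: "M \<lhd> G" and a: "a \<in> carrier G"
    and exp_G: "\<And>g. g \<in> carrier G \<Longrightarrow> g [^] (p ^ Suc m :: nat) = \<one>"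
    and exp_M: "\<And>c. c \<in> M \<Longrightarrow> c [^] (p ^ m :: nat) = \<one>"
    and c: "c \<in> M"
  shows "c \<otimes> a [^] (p ^ m :: nat) = a [^] (p ^ m :: nat) \<otimes> c"
proof -
  define S where "S = cyc_ext G M a"
  have S: "subgroup S G" unfolding S_def using finite_carrier M a by (rule subgroup_cyc_ext)
  interpret S: subgroup S G by (rule S)
  have aS: "a \<in> S" unfolding S_def using M a by (rule cyc_ext_self)
  have MS: "M \<subseteq> S" unfolding S_def using M by (rule subset_cyc_ext)
  have M': "M \<lhd> G\<lparr>carrier := S\<rparr>" using M S MS by (rule subgroup_normal_restrict)
  obtain Q :: "('a, 'b) monoid_scheme" and h where q: "quotient_hom (G\<lparr>carrier := S\<rparr>) Q h M"
    using normal.exists_quotient_hom[OF M'] .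
  have "a \<otimes> g \<otimes> inv a \<otimes> inv g \<in> M" if g: "g \<in> S" for g
    using quotient_hom.commutator_in_kernel[OF q, of a g 1] g aS S by (simp add: S_def)
  then show ?thesis
    using pow_central_of_commutators_bounded[OF power_closed_p_group_subgroup[OF S] p M', of a m c]
      aS MS c S exp_G exp_M by auto
qed

text \<open>For \<open>e = 0\<close> the element \<open>k\<close> is central and the product is \<open>x ^ p k ^ (p (p - 1) / 2)\<close>, which is \<open>\<one>\<close> for odd
  \<open>p\<close>. In the induction step the exponents are \<open>p ^ (e + 2)\<close> and \<open>p ^ (e + 1)\<close>; put \<open>n = p ^ (e + 1)\<close>.
  By induction in the quotient that lowers both exponents, the product \<open>W\<close> of length \<open>n\<close> is
  \<open>a ^ n c ^ (p ^ e)\<close> with \<open>c\<close> in \<open>M\<close>; the factors commute and have order dividing \<open>p\<close>, so \<open>W ^ p = \<one>\<close>.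
  Since \<open>k ^ n\<close> is central, the product of length \<open>p n\<close> consists of \<open>p\<close> blocks equal to \<open>W\<close> up to powers of
  \<open>k ^ (n ^ 2) = \<one>\<close>, so it is \<open>W ^ p\<close>.\<close>

theorem witness_prod_eq_one:
  fixes G :: "('a, 'b) monoid_scheme"
  assumes "power_closed_p_group G p" "odd p" "M \<lhd> G" "k \<in> carrier G"
    and "\<And>g. g \<in> carrier G \<Longrightarrow> k \<otimes>\<^bsub>G\<^esub> g \<otimes>\<^bsub>G\<^esub> inv\<^bsub>G\<^esub> k \<otimes>\<^bsub>G\<^esub> inv\<^bsub>G\<^esub> g \<in> M"
    and "\<And>g. g \<in> carrier G \<Longrightarrow> g [^]\<^bsub>G\<^esub> (p ^ Suc e :: nat) = \<one>\<^bsub>G\<^esub>"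
    and "\<And>c. c \<in> M \<Longrightarrow> c [^]\<^bsub>G\<^esub> (p ^ e :: nat) = \<one>\<^bsub>G\<^esub>"
    and "x \<in> carrier G"
  shows "witness_prod G k x (p ^ Suc e) = \<one>\<^bsub>G\<^esub>"
  using assms(1,3-)
proof (induction e arbitrary: G M k x)
  case 0
  interpret power_closed_p_group G p by fact
  note k = \<open>k \<in> carrier G\<close> and x = \<open>x \<in> carrier G\<close>
  interpret M: normal M G by fact
  have triv: "c = \<one>\<^bsub>G\<^esub>" if "c \<in> M" for c using 0(6)[OF that] that by simp
  have "g \<otimes>\<^bsub>G\<^esub> k = k \<otimes>\<^bsub>G\<^esub> g" if g: "g \<in> carrier G" for g
    using triv[OF 0(4)[OF g]] commutator_eq_one_iff[OF k g] by simp
  with k x have "witness_prod G k x p = x [^]\<^bsub>G\<^esub> p \<otimes>\<^bsub>G\<^esub> k [^]\<^bsub>G\<^esub> (\<Sum>i<p. i)"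
    by (rule witness_prod_central)
  also have "\<dots> = x [^]\<^bsub>G\<^esub> p \<otimes>\<^bsub>G\<^esub> (k [^]\<^bsub>G\<^esub> p) [^]\<^bsub>G\<^esub> ((p - 1) div 2)"
    using k \<open>odd p\<close> by (simp add: sum_below_odd nat_pow_pow)
  also have "\<dots> = \<one>\<^bsub>G\<^esub>" using 0(5)[OF k] 0(5)[OF x] by simp
  finally show ?case by simp
next
  case (Suc e)
  interpret power_closed_p_group G p by fact
  interpret M: normal M G by fact
  note k = \<open>k \<in> carrier G\<close> and x = \<open>x \<in> carrier G\<close>
  let ?n = "p ^ Suc e"
  let ?f = "\<lambda>x. x [^]\<^bsub>G\<^esub> (p ^ Suc e :: nat)"
  let ?h = "\<lambda>x. x [^]\<^bsub>G\<^esub> (p ^ e :: nat)"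
  let ?W = "witness_prod G k"
  have comm: "k \<otimes>\<^bsub>G\<^esub> g \<otimes>\<^bsub>G\<^esub> inv\<^bsub>G\<^esub> k \<otimes>\<^bsub>G\<^esub> inv\<^bsub>G\<^esub> g \<in> M" if "g \<in> carrier G" for g
    using Suc.prems(4) that .
  have exp_G: "g [^]\<^bsub>G\<^esub> (p ^ Suc (Suc e) :: nat) = \<one>\<^bsub>G\<^esub>" if "g \<in> carrier G" for g
    using Suc.prems(5) that .
  have exp_M: "?f c = \<one>\<^bsub>G\<^esub>" if "c \<in> M" for c using Suc.prems(6) that .
  obtain Q :: "('a, 'b) monoid_scheme" and q L where qq: "quotient_hom G Q q L"
    and exp_Q: "\<forall>y\<in>carrier Q. y [^]\<^bsub>Q\<^esub> (p ^ Suc e :: nat) = \<one>\<^bsub>Q\<^esub>"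
    and exp_qM: "\<forall>y\<in>q ` M. y [^]\<^bsub>Q\<^esub> (p ^ e :: nat) = \<one>\<^bsub>Q\<^esub>"
    and L_products: "\<forall>x\<in>L. \<exists>a\<in>carrier G. \<exists>c\<in>M. x = ?f a \<otimes>\<^bsub>G\<^esub> ?h c"
    using exists_exponent_lowering_quotient[OF M.normal_axioms, of e] by blast
  interpret q: quotient_hom G Q q L by (rule qq)
  have pcQ: "power_closed_p_group Q p" using qq by (rule power_closed_p_group_quotient)
  have comm_Q: "q k \<otimes>\<^bsub>Q\<^esub> y \<otimes>\<^bsub>Q\<^esub> inv\<^bsub>Q\<^esub> q k \<otimes>\<^bsub>Q\<^esub> inv\<^bsub>Q\<^esub> y \<in> q ` M" if "y \<in> carrier Q" for y
  proof -
    obtain a where a: "a \<in> carrier G" "q a = y" using q.lift[OF \<open>y \<in> carrier Q\<close>] .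
    have "q (k \<otimes>\<^bsub>G\<^esub> a \<otimes>\<^bsub>G\<^esub> inv\<^bsub>G\<^esub> k \<otimes>\<^bsub>G\<^esub> inv\<^bsub>G\<^esub> a) \<in> q ` M" using comm[OF a(1)] by (rule imageI)
    then show ?thesis using a k by simp
  qed
  have "witness_prod Q (q k) (q x) ?n = \<one>\<^bsub>Q\<^esub>"
    using pcQ q.normal_image[OF M.normal_axioms] q.hom_closed[OF k] comm_Q
      exp_Q[rule_format] exp_qM[rule_format] q.hom_closed[OF x]
    by (rule Suc.IH)
  then have "?W x ?n \<in> L" using k x q.ker[of "?W x ?n"] by (simp add: q.hom_witness_prod)
  then obtain a c where a: "a \<in> carrier G" and c: "c \<in> M" and W: "?W x ?n = ?f a \<otimes>\<^bsub>G\<^esub> ?h c"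
    using L_products by blast
  have "?h c \<in> M" using c by (rule M.subgroup_nat_pow_closed)
  then have "?h c \<otimes>\<^bsub>G\<^esub> ?f a = ?f a \<otimes>\<^bsub>G\<^esub> ?h c"
    using \<open>odd p\<close> M.normal_axioms a exp_G exp_M by (intro pow_commutes_with_bounded_normal)
  then have "?W x ?n [^]\<^bsub>G\<^esub> p = ?f a [^]\<^bsub>G\<^esub> p \<otimes>\<^bsub>G\<^esub> ?h c [^]\<^bsub>G\<^esub> p"
    unfolding W using a c by (intro pow_mult_distrib) auto
  also have "\<dots> = \<one>\<^bsub>G\<^esub>"
    using exp_G[OF a] exp_M[OF c] a c by (simp add: nat_pow_pow mult.commute)
  finally have W_p: "?W x ?n [^]\<^bsub>G\<^esub> p = \<one>\<^bsub>G\<^esub>" .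
  have central: "g \<otimes>\<^bsub>G\<^esub> ?f k = ?f k \<otimes>\<^bsub>G\<^esub> g" if "g \<in> carrier G" for g
    using power_closed_p_group_axioms \<open>odd p\<close> M.normal_axioms k comm exp_G exp_M that
    by (rule pow_central_of_commutators_bounded)
  have "?W x (j * ?n) = ?W x ?n [^]\<^bsub>G\<^esub> j" for j :: nat
  proof (induction j)
    case (Suc j)
    let ?z = "?f k [^]\<^bsub>G\<^esub> j"
    have z: "k [^]\<^bsub>G\<^esub> (j * ?n) = ?z" using k by (simp add: nat_pow_pow mult.commute)
    have zG: "?z \<in> carrier G" using k by simp
    have "?z \<otimes>\<^bsub>G\<^esub> g = g \<otimes>\<^bsub>G\<^esub> ?z" if "g \<in> carrier G" for g
      using central[OF that, symmetric] nat_pow_closed[OF k] that by (rule group_commutes_pow)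
    then have "?W (x \<otimes>\<^bsub>G\<^esub> ?z) ?n = ?W x ?n \<otimes>\<^bsub>G\<^esub> ?z [^]\<^bsub>G\<^esub> ?n"
      using k x zG by (intro witness_prod_mult_central) auto
    also have "?z [^]\<^bsub>G\<^esub> ?n = (k [^]\<^bsub>G\<^esub> (p ^ Suc (Suc e))) [^]\<^bsub>G\<^esub> (p ^ e * j)"
      using k by (simp add: nat_pow_pow ac_simps)
    also have "\<dots> = \<one>\<^bsub>G\<^esub>" unfolding exp_G[OF k] by simp
    finally have "?W (x \<otimes>\<^bsub>G\<^esub> ?z) ?n = ?W x ?n" using k x by simp
    moreover have "?W x (Suc j * ?n) = ?W (x \<otimes>\<^bsub>G\<^esub> ?z) ?n \<otimes>\<^bsub>G\<^esub> ?W x (j * ?n)"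
      using witness_prod_add[OF k x, of ?n "j * ?n"] by (simp only: z mult_Suc)
    ultimately have "?W x (Suc j * ?n) = ?W x ?n \<otimes>\<^bsub>G\<^esub> ?W x ?n [^]\<^bsub>G\<^esub> j" by (simp only: Suc)
    then show ?case using k x nat_pow_Suc2[of "?W x ?n" j] by simp
  qed simp
  from this[of p] show ?case using W_p by simp
qed

section \<open>Witnesses and J-groups\<close>

lemma (in group) witness_prod_period:
  assumes k: "k \<in> carrier G" and x: "x \<in> carrier G" and n: "k [^] n = \<one>" "witness_prod G k x n = \<one>"
  shows "witness_prod G k x (i + j * n) = witness_prod G k x i"
proof (induction j)
  case (Suc j)
  have "witness_prod G k x (i + Suc j * n) = witness_prod G k (x \<otimes> k [^] n) (i + j * n) \<otimes> witness_prod G k x n"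
    using witness_prod_add[OF k x, of "i + j * n" n] by (simp add: ac_simps)
  then show ?case using Suc k x n by simp
qed simp

text \<open>Choose a representative \<open>r\<close> of each left coset of the subgroup generated by \<open>k\<close>, and put
  \<open>f (r k ^ i) = witness_prod G k r i\<close>. The witness property says that this depends on \<open>i\<close> only modulo the
  order of \<open>k\<close>.\<close>

theorem witness_imp_J_group:
  fixes G (structure)
  assumes G: "group G" and k: "k \<in> witnesses G"
  shows "J_group G"
proof -
  interpret group G by (rule G)
  define n where "n = ord k"
  have kG: "k \<in> carrier G" and n0: "n > 0" and W: "\<And>x. x \<in> carrier G \<Longrightarrow> witness_prod G k x n = \<one>"
    using k unfolding witnesses_iff n_def by auto
  have kn: "k [^] n = \<one>" using kG by (simp add: n_def)
  have W_cong: "witness_prod G k x a = witness_prod G k x b"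
    if x: "x \<in> carrier G" and eq: "k [^] a = k [^] b" for x and a b :: nat
  proof -
    have le: "witness_prod G k x a = witness_prod G k x b" if "b \<le> a" "k [^] a = k [^] b" for a b :: nat
    proof -
      have "k [^] (a - b) = \<one>" using kG that(2) by (rule pow_eq_div2)
      then obtain j where "a - b = n * j" using pow_eq_id[OF kG] unfolding n_def by blast
      then have "a = b + j * n" using that(1) by (simp add: mult.commute)
      then show ?thesis using witness_prod_period[OF kG x kn W[OF x], of b j] by simp
    qed
    show ?thesis using le[of a b] le[of b a] eq by (cases "b \<le> a") auto
  qed
  define cl where "cl x = range (\<lambda>i::nat. x \<otimes> k [^] i)" for x
  define r where "r x = (SOME y. y \<in> cl x)" for x
  have shift: "x \<otimes> k [^] i \<otimes> k [^] (i * (n - 1)) = x" if "x \<in> carrier G" for x and i :: nat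
  proof -
    have "i + i * (n - 1) = n * i" using n0 by (cases n) auto
    then have "k [^] i \<otimes> k [^] (i * (n - 1)) = (k [^] n) [^] i"
      using kG by (simp only: nat_pow_mult nat_pow_pow)
    then have "k [^] i \<otimes> k [^] (i * (n - 1)) = \<one>" using kn by simp
    then show ?thesis using that kG by (simp add: m_assoc)
  qed
  have r_cl: "\<exists>i::nat. r x = x \<otimes> k [^] i" for x
  proof -
    have "r x \<in> cl x" unfolding r_def by (rule someI[of _ "x \<otimes> k [^] (0::nat)"]) (unfold cl_def, rule rangeI)
    then show ?thesis unfolding cl_def by blast
  qed
  have rG: "r x \<in> carrier G" if "x \<in> carrier G" for x using r_cl[of x] that kG by auto
  have index: "\<exists>i::nat. x = r x \<otimes> k [^] i" if "x \<in> carrier G" for x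
    using r_cl[of x] shift[OF that] by metis
  have cl_mult: "cl (x \<otimes> k) = cl x" if x: "x \<in> carrier G" for x
  proof -
    have *: "x \<otimes> k \<otimes> k [^] i = x \<otimes> k [^] Suc i" for i :: nat
      using x kG nat_pow_Suc2[OF kG, of i] by (simp add: m_assoc)
    have "x \<otimes> k [^] i \<in> cl (x \<otimes> k)" for i :: nat
    proof -
      have "k [^] i = k [^] Suc (i + (n - 1))" using n0 kn kG nat_pow_mult[OF kG, of i n] by simp
      then show ?thesis unfolding cl_def * by (metis rangeI)
    qed
    moreover have "cl (x \<otimes> k) \<subseteq> cl x" unfolding cl_def * by blast
    ultimately show ?thesis unfolding cl_def[of x] by blast
  qed
  have r_mult: "r (x \<otimes> k) = r x" if "x \<in> carrier G" for x
    unfolding r_def cl_mult[OF that] ..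
  define idx where "idx x = (SOME i::nat. x = r x \<otimes> k [^] i)" for x
  have idx: "r x \<otimes> k [^] idx x = x" if "x \<in> carrier G" for x
    using someI_ex[OF index[OF that]] unfolding idx_def by simp
  define f where "f x = witness_prod G k (r x) (idx x)" for x
  have "f (x \<otimes> k) = x \<otimes> f x" if x: "x \<in> carrier G" for x
  proof -
    have "r x \<otimes> k [^] idx (x \<otimes> k) = x \<otimes> k" using idx[of "x \<otimes> k"] r_mult[OF x] x kG by simp
    also have "\<dots> = r x \<otimes> k [^] Suc (idx x)"
      using idx[OF x] rG[OF x] kG m_assoc[of "r x" "k [^] idx x" k] by simp
    finally have "k [^] idx (x \<otimes> k) = k [^] Suc (idx x)" using rG[OF x] kG by simp
    then have "f (x \<otimes> k) = witness_prod G k (r x) (Suc (idx x))"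
      unfolding f_def r_mult[OF x] using rG[OF x] by (intro W_cong)
    then show ?thesis using idx[OF x] by (simp add: f_def)
  qed
  moreover have "f \<in> carrier G \<rightarrow> carrier G" using rG kG by (auto simp: f_def)
  ultimately show ?thesis unfolding J_group_def using G kG by blast
qed

section \<open>Exponents and the lower central series\<close>

lemma (in group) ord_subgroup_eq:
  assumes "subgroup H G" shows "group.ord (G\<lparr>carrier := H\<rparr>) x = ord x"
  using group.ord_def[OF subgroup_imp_group[OF assms]] by (simp add: ord_def)

context p_group
begin

text \<open>The orders of elements are powers of \<open>p\<close>, hence form a chain under divisibility, and their least common multiple
  is the largest of them.\<close>

lemma exists_ord_eq_group_exp: "\<exists>x\<in>carrier G. ord x = group_exp G"
proof -
  have "finite (ord ` carrier G)" "ord ` carrier G \<noteq> {}" using finite_carrier by auto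
  then have "Max (ord ` carrier G) \<in> ord ` carrier G" by (rule Max_in)
  then obtain x where x: "x \<in> carrier G" "ord x = Max (ord ` carrier G)" by (metis imageE)
  have "ord y dvd ord x" if y: "y \<in> carrier G" for y
  proof -
    obtain a b where "ord y = p ^ a" "ord x = p ^ b" using ord_eq_power x y by metis
    moreover have "ord y \<le> ord x" unfolding x(2) using finite_carrier y by (intro Max_ge) auto
    ultimately show ?thesis using p_gt_1 by (simp add: le_imp_power_dvd)
  qed
  then have "group_exp G dvd ord x" unfolding group_exp_def by (auto intro: Lcm_least)
  moreover have "ord x dvd group_exp G" unfolding group_exp_def using x(1) by (intro dvd_Lcm) simp
  ultimately have "ord x = group_exp G" by (intro dvd_antisym)
  then show ?thesis using x(1) by blast
qed

lemma pow_group_exp: "x \<in> carrier G \<Longrightarrow> x [^] group_exp G = \<one>"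
  unfolding group_exp_def pow_eq_id by (intro dvd_Lcm imageI)

lemma group_exp_subgroup_dvd:
  assumes H: "subgroup H G" shows "group_exp (G\<lparr>carrier := H\<rparr>) dvd group_exp G"
  unfolding group_exp_def
  by (rule Lcm_least) (use subgroup.mem_carrier[OF H] in \<open>auto simp: ord_subgroup_eq[OF H] intro: dvd_Lcm\<close>)

end

context group
begin

lemma commutator_subgroup_normal:
  assumes "H \<lhd> G" shows "commutator_subgroup G H (carrier G) \<lhd> G"
  unfolding commutator_subgroup_def
proof (rule normal_generateI)
  interpret H: normal H G by fact
  let ?S = "\<Union>h\<in>H. \<Union>k\<in>carrier G. {h \<otimes> k \<otimes> inv h \<otimes> inv k}"
  show "?S \<subseteq> carrier G" by auto
  fix s g assume s: "s \<in> ?S" and g: "g \<in> carrier G"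
  obtain h k where hk: "h \<in> H" "k \<in> carrier G" "s = h \<otimes> k \<otimes> inv h \<otimes> inv k" using s by blast
  have cancel: "inv g \<otimes> (g \<otimes> y) = y" if "y \<in> carrier G" for y
    using g that by (simp add: m_assoc[symmetric])
  have "g \<otimes> s \<otimes> inv g = (g \<otimes> h \<otimes> inv g) \<otimes> (g \<otimes> k \<otimes> inv g) \<otimes> inv (g \<otimes> h \<otimes> inv g) \<otimes> inv (g \<otimes> k \<otimes> inv g)"
    using hk g by (simp add: m_assoc inv_mult_group cancel)
  moreover have "g \<otimes> h \<otimes> inv g \<in> H" using H.inv_op_closed2[OF g hk(1)] .
  moreover have "g \<otimes> k \<otimes> inv g \<in> carrier G" using g hk by simp
  ultimately show "g \<otimes> s \<otimes> inv g \<in> ?S" by blast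
qed

lemma commutator_in_commutator_subgroup:
  "h \<in> H \<Longrightarrow> k \<in> K \<Longrightarrow> h \<otimes> k \<otimes> inv h \<otimes> inv k \<in> commutator_subgroup G H K"
  unfolding commutator_subgroup_def by (rule generate.incl) blast

lemma lower_central_normal: "lower_central G i \<lhd> G"
proof -
  have carrier: "carrier G \<lhd> G" by (rule normal_invI[OF subgroup_self]) simp
  have "lower_central G (Suc n) \<lhd> G" for n
    by (induction n) (simp_all add: carrier commutator_subgroup_normal)
  then show ?thesis using carrier by (cases i) simp_all
qed

lemma lower_central_subgroup: "subgroup (lower_central G i) G"
  using lower_central_normal by (rule normal_imp_subgroup)

lemma commutator_in_lower_central:
  assumes "k \<in> lower_central G d" "g \<in> carrier G" "d \<ge> 1"
  shows "k \<otimes> g \<otimes> inv k \<otimes> inv g \<in> lower_central G (Suc d)"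
  using assms by (cases d) (auto intro: commutator_in_commutator_subgroup)

lemma lower_central_Suc_trivial:
  assumes d: "d \<ge> 1" and central: "\<And>z g. z \<in> lower_central G d \<Longrightarrow> g \<in> carrier G \<Longrightarrow> z \<otimes> g = g \<otimes> z"
  shows "lower_central G (Suc d) = {\<one>}"
proof -
  obtain i where i: "d = Suc i" using d by (cases d) auto
  let ?S = "\<Union>h\<in>lower_central G d. \<Union>k\<in>carrier G. {h \<otimes> k \<otimes> inv h \<otimes> inv k}"
  have "?S \<subseteq> {\<one>}"
  proof
    fix s assume "s \<in> ?S"
    then obtain h k where hk: "h \<in> lower_central G d" "k \<in> carrier G" "s = h \<otimes> k \<otimes> inv h \<otimes> inv k" by blast
    have "h \<in> carrier G" using subgroup.mem_carrier[OF lower_central_subgroup hk(1)] .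
    then show "s \<in> {\<one>}" using central[OF hk(1,2)] hk commutator_eq_one_iff[of h k] by simp
  qed
  then have "generate G ?S \<subseteq> {\<one>}" by (intro generate_subgroup_incl triv_subgroup)
  moreover have "lower_central G (Suc d) = generate G ?S" by (simp add: i commutator_subgroup_def)
  ultimately show ?thesis using subgroup.one_closed[OF lower_central_subgroup[of "Suc d"]] by blast
qed

end

lemma (in group_hom) hom_lower_central:
  "x \<in> lower_central G i \<Longrightarrow> h x \<in> lower_central H i"
proof -
  have "h ` lower_central G (Suc n) \<subseteq> lower_central H (Suc n)" for n
  proof (induction n)
    case (Suc n)
    let ?S = "\<lambda>G. \<Union>h\<in>lower_central G (Suc n). \<Union>k\<in>carrier G. {h \<otimes>\<^bsub>G\<^esub> k \<otimes>\<^bsub>G\<^esub> inv\<^bsub>G\<^esub> h \<otimes>\<^bsub>G\<^esub> inv\<^bsub>G\<^esub> k}"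
    note sub = subgroup.mem_carrier[OF G.lower_central_subgroup]
    have "h ` ?S G \<subseteq> ?S H"
    proof
      fix y assume "y \<in> h ` ?S G"
      then obtain a k where ak: "a \<in> lower_central G (Suc n)" "k \<in> carrier G"
        "y = h (a \<otimes> k \<otimes> inv a \<otimes> inv k)" by blast
      then have "y = h a \<otimes>\<^bsub>H\<^esub> h k \<otimes>\<^bsub>H\<^esub> inv\<^bsub>H\<^esub> h a \<otimes>\<^bsub>H\<^esub> inv\<^bsub>H\<^esub> h k"
        using sub[OF ak(1)] by simp
      moreover have "h a \<in> lower_central H (Suc n)" using ak(1) Suc by blast
      moreover have "h k \<in> carrier H" using ak(2) by simp
      ultimately show "y \<in> ?S H" by blast
    qed
    moreover have S_carrier: "?S G \<subseteq> carrier G" using sub by auto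
    ultimately have "h ` generate G (?S G) \<subseteq> generate H (?S H)"
      unfolding generate_img[OF S_carrier, symmetric] by (intro H.mono_generate)
    then show ?case by (simp add: commutator_subgroup_def)
  qed auto
  then show "x \<in> lower_central G i \<Longrightarrow> h x \<in> lower_central H i" by (cases i) auto
qed

text \<open>If a term of the series vanishes modulo a central subgroup, then it is central and the next term is
  trivial.\<close>

theorem p_group_nilpotent:
  fixes G :: "('a, 'b) monoid_scheme"
  assumes "p_group G p"
  shows "\<exists>c\<ge>1. lower_central G c = {\<one>\<^bsub>G\<^esub>}"
  using assms
proof (induction "order G" arbitrary: G rule: less_induct)
  case less
  interpret p_group G p by fact
  show ?case
  proof (cases "carrier G = {\<one>\<^bsub>G\<^esub>}")
    case True
    then show ?thesis by (intro exI[of _ "Suc 0"]) simp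
  next
    case False
    obtain z where z: "z \<in> carrier G" "z \<noteq> \<one>\<^bsub>G\<^esub>" "\<forall>g\<in>carrier G. g \<otimes>\<^bsub>G\<^esub> z = z \<otimes>\<^bsub>G\<^esub> g"
      using central_subgroup_order_p[OF False] by blast
    define Z where "Z = cyc_ext G {\<one>\<^bsub>G\<^esub>} z"
    have Z: "Z \<lhd> G" unfolding Z_def
      using finite_carrier z(1,3) by (rule normal_cyc_ext_central)
    have zZ: "z \<in> Z" unfolding Z_def using one_is_normal z(1) by (rule cyc_ext_self)
    obtain Q :: "('a, 'b) monoid_scheme" and h where q: "quotient_hom G Q h Z"
      using normal.exists_quotient_hom[OF Z] .
    interpret q: quotient_hom G Q h Z by (rule q)
    obtain c where c: "c \<ge> 1" "lower_central Q c = {\<one>\<^bsub>Q\<^esub>}"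
      using less.hyps[OF q.order_less[OF finite_carrier zZ z(2)] p_group_quotient[OF q]] by blast
    have "lower_central G (Suc c) = {\<one>\<^bsub>G\<^esub>}"
    proof (rule lower_central_Suc_trivial[OF c(1)])
      fix y g assume y: "y \<in> lower_central G c" and g: "g \<in> carrier G"
      have "h y = \<one>\<^bsub>Q\<^esub>" using q.hom_lower_central[OF y] c(2) by simp
      then have "y \<in> Z" using q.ker subgroup.mem_carrier[OF lower_central_subgroup y] by simp
      then obtain i :: nat where "y = z [^]\<^bsub>G\<^esub> i" unfolding Z_def cyc_ext_one[OF z(1)] by blast
      moreover have "z \<otimes>\<^bsub>G\<^esub> g = g \<otimes>\<^bsub>G\<^esub> z" using z(3) g by simp
      ultimately show "y \<otimes>\<^bsub>G\<^esub> g = g \<otimes>\<^bsub>G\<^esub> y" using z(1) g by (simp add: group_commutes_pow)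
    qed
    then show ?thesis using c(1) by (intro exI[of _ "Suc c"]) simp
  qed
qed

text \<open>The greatest element in the definition of \<open>exp_depth\<close> exists because the series reaches the trivial group, whose
  exponent \<open>1\<close> differs from that of \<open>G\<close>.\<close>

lemma (in p_group) exp_depth_properties:
  assumes nontriv: "carrier G \<noteq> {\<one>}"
  shows "exp_depth G \<ge> 1"
    and "group_exp (lower_central_group G (exp_depth G)) = group_exp G"
    and "group_exp (lower_central_group G (Suc (exp_depth G))) \<noteq> group_exp G"
proof -
  let ?P = "\<lambda>d. d \<ge> 1 \<and> group_exp (lower_central_group G d) = group_exp G"
  have not_triv: "\<not> trivial_group G"
    using nontriv unfolding trivial_group_def by auto
  have depth: "exp_depth G = (GREATEST d. ?P d)" unfolding exp_depth_def using not_triv by simp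
  obtain c where c: "c \<ge> 1" "lower_central G c = {\<one>}" using p_group_nilpotent[OF p_group_axioms] by blast
  have triv_above: "lower_central G d = {\<one>}" if "c \<le> d" for d
    using that
  proof (induction d rule: dec_induct)
    case (step d)
    then show ?case using c(1) by (intro lower_central_Suc_trivial) auto
  qed (rule c(2))
  have exp_not_1: "group_exp G \<noteq> 1"
  proof
    assume "group_exp G = 1"
    then have "x = \<one>" if "x \<in> carrier G" for x using pow_group_exp[OF that] that by simp
    then show False using nontriv by blast
  qed
  have bound: "d \<le> c" if "?P d" for d
  proof (rule ccontr)
    assume "\<not> d \<le> c"
    then have triv: "lower_central G d = {\<one>}" by (intro triv_above) simp
    have "group_exp (lower_central_group G d) = 1"
      unfolding group_exp_def using ord_subgroup_eq[OF lower_central_subgroup, of d] by (simp add: triv)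
    then show False using that exp_not_1 by simp
  qed
  have P1: "?P 1" by simp
  have "?P (exp_depth G)" unfolding depth by (rule GreatestI_nat[of ?P, OF P1 bound])
  then show "exp_depth G \<ge> 1" and "group_exp (lower_central_group G (exp_depth G)) = group_exp G" by simp_all
  show "group_exp (lower_central_group G (Suc (exp_depth G))) \<noteq> group_exp G"
  proof
    assume "group_exp (lower_central_group G (Suc (exp_depth G))) = group_exp G"
    then have "?P (Suc (exp_depth G))" by simp
    then have "Suc (exp_depth G) \<le> (GREATEST d. ?P d)" using bound by (rule Greatest_le_nat)
    then show False unfolding depth by simp
  qed
qed

lemma (in group) witness_of_trivial_group:
  assumes "carrier G = {\<one>}" shows "\<one> \<in> witnesses G"
  unfolding witnesses_iff using assms by simp

text \<open>Take \<open>M\<close> to be the term of the lower central series after \<open>\<gamma>\<^sub>d(G)\<close>. Its exponent is a proper divisor of that of \<open>G\<close>, and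
  elements of \<open>\<gamma>\<^sub>d(G)\<close> have all their commutators in \<open>M\<close>.\<close>

theorem (in power_closed_p_group) max_order_elements_witnesses:
  assumes p: "odd p"
  shows "max_order_elements (lower_central_group G (exp_depth G)) \<subseteq> witnesses G"
proof (cases "carrier G = {\<one>}")
  case True
  then have "lower_central G (exp_depth G) \<subseteq> {\<one>}"
    using subgroup.subset[OF lower_central_subgroup] by metis
  then show ?thesis
    using witness_of_trivial_group[OF True] unfolding max_order_elements_def by auto
next
  case False
  let ?d = "exp_depth G"
  note depth = exp_depth_properties[OF False]
  let ?M = "lower_central G (Suc ?d)"
  interpret M: p_group "G\<lparr>carrier := ?M\<rparr>" p using lower_central_subgroup by (rule p_group_subgroup)
  obtain x0 where x0: "x0 \<in> carrier G" "ord x0 = group_exp G" using exists_ord_eq_group_exp by blast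
  obtain n where n: "group_exp G = p ^ n" using ord_eq_power[OF x0(1)] x0(2) by metis
  obtain m where m: "group_exp (G\<lparr>carrier := ?M\<rparr>) = p ^ m"
    using M.exists_ord_eq_group_exp M.ord_eq_power by metis
  have "p ^ m dvd p ^ n" using group_exp_subgroup_dvd[OF lower_central_subgroup, of "Suc ?d"] n m by simp
  then have "m \<le> n" using p_gt_1 power_dvd_imp_le by blast
  moreover have "m \<noteq> n" using depth(3) n m by auto
  ultimately obtain e where e: "n = Suc e" "m \<le> e" by (cases n) auto
  have exp_G: "g [^] (p ^ Suc e :: nat) = \<one>" if "g \<in> carrier G" for g
    using pow_group_exp[OF that] n e(1) by simp
  have exp_M: "c [^] (p ^ e :: nat) = \<one>" if c: "c \<in> ?M" for c
  proof -
    have cG: "c \<in> carrier G" using subgroup.mem_carrier[OF lower_central_subgroup c] .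
    have "c [^] (p ^ m :: nat) = \<one>" using M.pow_group_exp[of c] c m by simp
    then have "(c [^] (p ^ m :: nat)) [^] (p ^ (e - m) :: nat) = \<one>" by simp
    then show ?thesis using cG e(2) by (simp add: nat_pow_pow power_add[symmetric])
  qed
  show ?thesis
  proof
    fix k assume "k \<in> max_order_elements (lower_central_group G ?d)"
    then have k: "k \<in> lower_central G ?d" and ord_k: "ord k = p ^ Suc e"
      using depth(2) n e(1) ord_subgroup_eq[OF lower_central_subgroup, of ?d k]
      by (auto simp: max_order_elements_def)
    have kG: "k \<in> carrier G" using subgroup.mem_carrier[OF lower_central_subgroup k] .
    have "witness_prod G k x (p ^ Suc e) = \<one>" if "x \<in> carrier G" for x
      using power_closed_p_group_axioms p lower_central_normal kG
        commutator_in_lower_central[OF k _ depth(1)] exp_G exp_M that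
      by (rule witness_prod_eq_one)
    then show "k \<in> witnesses G"
      unfolding witnesses_iff ord_k using kG p_gt_1 by simp
  qed
qed

theorem theorem4p15:
  fixes p :: nat and G :: "('a, 'b) monoid_scheme"
  assumes "Factorial_Ring.prime p" and "odd p"
    and "finite_p_group p G"
    and "power_closed p G"
  shows "J_group G \<and>
    max_order_elements (lower_central_group G (exp_depth G)) \<subseteq> witnesses G"
proof -
  interpret power_closed_p_group G p
    using assms by (simp add: power_closed_p_group_def power_closed_p_group_axioms_def finite_p_group_iff)
  let ?D = "lower_central_group G (exp_depth G)"
  interpret D: p_group ?D p using lower_central_subgroup by (rule p_group_subgroup)
  have witnesses: "max_order_elements ?D \<subseteq> witnesses G"
    using \<open>odd p\<close> by (rule max_order_elements_witnesses)
  obtain k where "k \<in> max_order_elements ?D"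
    using D.exists_ord_eq_group_exp unfolding max_order_elements_def by auto
  then have "k \<in> witnesses G" using witnesses by blast
  then have "J_group G" by (rule witness_imp_J_group[OF group_axioms])
  then show ?thesis using witnesses by blast
qed

end
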